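(* Let $\mathcal{R}=\mathbb{C}[\partial]A\oplus\mathbb{C}[\partial]B$ be a rank two Lie conformal algebra of Type II with $Q\neq0$, let $V_{\alpha,\beta}=\mathbb{C}[\partial]v$ be a nontrivial finite irreducible $\mathcal{R}$-module and let $\eta\in\mathbb{C}$. Consider extensions of $\mathcal{R}$-modules of the form $$0\longrightarrow V_{\alpha,\beta}\longrightarrow E\longrightarrow\mathbb{C}c_\eta\longrightarrow0 .\qquad(\ast)$$ Every such $E$ is, as a vector space, $\mathbb{C}[\partial]v\oplus\mathbb{C}c_\eta$ with $$A_\lambda v=(\partial+\alpha\lambda+\beta)v,\quad B_\lambda v=0,\quad A_\lambda c_\eta=f(\partial,\lambda)v,\quad B_\lambda c_\eta=g(\partial,\lambda)v,\quad\partial c_\eta=\eta c_\eta+h(\partial)v\qquad(\ast\ast)$$ for some $f,g\in\mathbb{C}[\partial,\lambda]$, $h\in\mathbb{C}[\partial]$. Nontrivial extensions of the form $(\ast)$ exist only if $\beta+\eta=0$ and $\alpha=1$. Moreover, in this case they are given (up to equivalence) by $(\ast\ast)$ with $g(\partial,\lambda)=0$ and $f(\partial,\lambda)=h(\partial)=s$ with a nonzero constant $s$, and $\dim\mathrm{Ext}(\mathbb{C}c_\eta,V_{\alpha,\beta})=1$.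
   Context: Everything is over $\mathbb{C}$. A Lie conformal algebra $\mathcal{R}$ is a $\mathbb{C}[\partial]$-module with a $\mathbb{C}$-linear $\lambda$-bracket $\mathcal{R}\otimes\mathcal{R}\to\mathcal{R}[\lambda]$, $a\otimes b\mapsto[a_\lambda b]$, satisfying $[\partial a_\lambda b]=-\lambda[a_\lambda b]$, $[a_\lambda\partial b]=(\partial+\lambda)[a_\lambda b]$, $[a_\lambda b]=-[b_{-\lambda-\partial}a]$ and $[a_\lambda[b_\mu c]]=[[a_\lambda b]_{\lambda+\mu}c]+[b_\mu[a_\lambda c]]$. A conformal $\mathcal{R}$-module $V$ is a $\mathbb{C}[\partial]$-module with a $\mathbb{C}$-linear map $\mathcal{R}\otimes V\to V[\lambda]$, $a\otimes v\mapsto a_\lambda v$, satisfying $(\partial a)_\lambda v=-\lambda(a_\lambda v)$, $a_\lambda(\partial v)=(\partial+\lambda)a_\lambda v$, $a_\lambda(b_\mu v)=[a_\lambda b]_{\lambda+\mu}v+b_\mu(a_\lambda v)$. For $\eta\in\mathbb{C}$, $\mathbb{C}c_\eta$ is the one-dimensional module with $\partial c_\eta=\eta c_\eta$ and $\mathcal{R}_\lambda c_\eta=0$. An extension of $W$ by $V$ is an exact sequence of modules $0\to V\to E\to W\to0$. Two extensions $E,E'$ are equivalent if there is a module homomorphism $E\to E'$ compatible with the identity maps of $V$ and $W$. An extension is trivial if it is equivalent to $V\oplus W$. $\mathrm{Ext}(W,V)$ is the vector space of extension cocycles modulo those equivalent to the trivial extension, and $\dim\mathrm{Ext}(W,V)$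 is its dimension. A Type II rank two Lie conformal algebra with $Q\neq0$ has free basis $\{A,B\}$ over $\mathbb{C}[\partial]$ with $[A_\lambda A]=(\partial+2\lambda)A+Q(\partial,\lambda)B$, $[A_\lambda B]=(\partial+a\lambda)B$, $[B_\lambda B]=0$, where $a\in\{1,0,-1,-4,-6\}$ and, for some $c,d\in\mathbb{C}$, the nonzero polynomial $Q$ is: for $a=1$, $Q=c(\partial+2\lambda)$; for $a=0$, $Q=c(\partial+2\lambda)(\partial+\lambda)\lambda+d(\partial+2\lambda)\partial$; for $a=-1$, $Q=c(\partial+2\lambda)\partial^2+d(\partial+2\lambda)(\partial+\lambda)\partial\lambda$; for $a=-4$, $Q=c(\partial+2\lambda)(\partial+\lambda)^3\lambda^3$; for $a=-6$, $Q=c(\partial+2\lambda)[11(\partial+\lambda)^4\lambda^4+2(\partial+\lambda)^3\partial^2\lambda^3]$. Its nontrivial finite irreducible modules are $V_{\alpha,\beta}=\mathbb{C}[\partial]v$ (free of rank one) with $A_\lambda v=(\partial+\alpha\lambda+\beta)v$, $B_\lambda v=0$, where $\beta\in\mathbb{C}$, $0\neq\alpha\in\mathbb{C}$. *)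

theory Defs
  imports
    Complex_Main
    "HOL-Library.Product_Plus"
    "HOL-Computational_Algebra.Polynomial"
    "HOL-Algebra.AbelCoset"
    "Jordan_Normal_Form.VS_Connect"
begin

section \<open>\<open>\<complex>[\<partial>]\<close>-modules\<close>

text \<open>
  A \<open>\<complex>[\<partial>]\<close>-module is a complex vector space (scalar multiplication \<open>scl\<close>) on a whole type,
  together with a linear operator \<open>del\<close>.  For such a module \<open>V\<close>, an element of \<open>V[\<lambda>]\<close> is a
  polynomial of type \<open>'v poly\<close>: its coefficients are vectors, \<open>pCons 0\<close> is multiplication by
  \<open>\<lambda>\<close>, and \<open>map_poly T\<close> applies an additive map \<open>T\<close> coefficientwise.
\<close>

record 'v dmod =
  scl :: "complex \<Rightarrow> 'v \<Rightarrow> 'v"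
  del :: "'v \<Rightarrow> 'v"

definition is_dmod :: "('v::ab_group_add, 'z) dmod_scheme \<Rightarrow> bool" where
  "is_dmod M \<longleftrightarrow> vector_space (scl M) \<and> Vector_Spaces.linear (scl M) (scl M) (del M)"

definition pact :: "('v::ab_group_add, 'z) dmod_scheme \<Rightarrow> complex poly \<Rightarrow> 'v \<Rightarrow> 'v" where
  "pact M p x = (\<Sum>i\<le>degree p. scl M (coeff p i) ((del M ^^ i) x))"

text \<open>
  A polynomial \<open>f(\<partial>,\<lambda>)\<close> is an element of \<open>\<complex>[\<partial>][\<lambda>]\<close>, i.e. the inner variable of
  \<open>complex poly poly\<close> is \<open>\<partial>\<close> and the outer one is \<open>\<lambda>\<close>; \<open>pact2 M f x\<close> is \<open>f(\<partial>,\<lambda>)x \<in> M[\<lambda>]\<close>.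
\<close>

definition dvar :: "complex poly poly" where "dvar = [:[:0, 1:]:]"
definition lvar :: "complex poly poly" where "lvar = [:0, 1:]"
definition cnst :: "complex \<Rightarrow> complex poly poly" where "cnst k = [:[:k:]:]"

definition pact2 ::
  "('v::ab_group_add, 'z) dmod_scheme \<Rightarrow> complex poly poly \<Rightarrow> 'v \<Rightarrow> 'v poly" where
  "pact2 M f x = map_poly (\<lambda>p. pact M p x) f"

section \<open>Lie conformal algebras and conformal modules\<close>

record (overloaded) ('r::zero) lca = "'r dmod" +
  br :: "'r \<Rightarrow> 'r \<Rightarrow> 'r poly"    \<comment> \<open>\<open>br R a b\<close> is \<open>[a\<^sub>\<lambda> b]\<close>\<close>

record (overloaded) ('r, 'v::zero) cmod = "'v dmod" +
  act :: "'r \<Rightarrow> 'v \<Rightarrow> 'v poly"    \<comment> \<open>\<open>act M a v\<close> is \<open>a\<^sub>\<lambda> v\<close>\<close>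

text \<open>
  Elements of \<open>V[\<lambda>,\<mu>]\<close> are represented in \<open>V[\<lambda>][\<mu>]\<close>, i.e. in \<open>'v poly poly\<close> with inner variable
  \<open>\<lambda>\<close> and outer variable \<open>\<mu>\<close>.  So \<open>pCons 0\<close> is multiplication by \<open>\<mu>\<close> and \<open>map_poly (pCons 0)\<close>
  is multiplication by \<open>\<lambda>\<close>.
\<close>

definition mult_lam :: "'v::ab_group_add poly poly \<Rightarrow> 'v poly poly" where
  "mult_lam q = map_poly (pCons 0) q"

definition mult_lam_mu :: "'v::ab_group_add poly poly \<Rightarrow> 'v poly poly" where
  "mult_lam_mu q = mult_lam q + pCons 0 q"

text \<open>\<open>p(\<lambda>+\<mu>)\<close> for \<open>p \<in> V[\<lambda>]\<close>.\<close>

definition subst_lam_mu :: "'v::ab_group_add poly \<Rightarrow> 'v poly poly" where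
  "subst_lam_mu p = (\<Sum>i\<le>degree p. (mult_lam_mu ^^ i) [:[:coeff p i:]:])"

text \<open>Exchange of the inner and the outer variable.\<close>

definition swap_vars :: "'v::ab_group_add poly poly \<Rightarrow> 'v poly poly" where
  "swap_vars q = (\<Sum>i\<le>degree q. map_poly (\<lambda>x. monom x i) (coeff q i))"

text \<open>The three terms of the Jacobi identity:
  \<open>a\<^sub>\<lambda>(b\<^sub>\<mu> v)\<close>, \<open>b\<^sub>\<mu>(a\<^sub>\<lambda> v)\<close> and \<open>p\<^sub>\<lambda>\<^sub>+\<^sub>\<mu> v\<close>.  In the last one \<open>p \<in> R[\<lambda>]\<close> (which will be
  \<open>[a\<^sub>\<lambda> b]\<close>), so that \<open>(\<Sum>\<^sub>i \<lambda>\<^sup>i x\<^sub>i)\<^sub>\<lambda>\<^sub>+\<^sub>\<mu> v = \<Sum>\<^sub>i \<lambda>\<^sup>i (x\<^sub>i)\<^sub>\<lambda>\<^sub>+\<^sub>\<mu> v\<close>.\<close>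

definition act_lam_mu ::
  "('r \<Rightarrow> 'v \<Rightarrow> 'v poly) \<Rightarrow> 'r \<Rightarrow> 'r \<Rightarrow> 'v::ab_group_add \<Rightarrow> 'v poly poly" where
  "act_lam_mu \<rho> a b v = map_poly (\<rho> a) (\<rho> b v)"

definition act_mu_lam ::
  "('r \<Rightarrow> 'v \<Rightarrow> 'v poly) \<Rightarrow> 'r \<Rightarrow> 'r \<Rightarrow> 'v::ab_group_add \<Rightarrow> 'v poly poly" where
  "act_mu_lam \<rho> a b v = swap_vars (map_poly (\<rho> b) (\<rho> a v))"

definition act_sum ::
  "('r \<Rightarrow> 'v \<Rightarrow> 'v poly) \<Rightarrow> 'r::ab_group_add poly \<Rightarrow> 'v::ab_group_add \<Rightarrow> 'v poly poly" where
  "act_sum \<rho> p v = (\<Sum>i\<le>degree p. (mult_lam ^^ i) (subst_lam_mu (\<rho> (coeff p i) v)))"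

definition conformal_module ::
  "'r::ab_group_add lca \<Rightarrow> ('r, 'v::ab_group_add) cmod \<Rightarrow> bool" where
  "conformal_module R M \<longleftrightarrow>
     is_dmod M \<and>
     (\<forall>v. Vector_Spaces.linear (scl R) (\<lambda>k. map_poly (scl M k)) (\<lambda>a. act M a v)) \<and>
     (\<forall>a. Vector_Spaces.linear (scl M) (\<lambda>k. map_poly (scl M k)) (act M a)) \<and>
     (\<forall>a v. act M (del R a) v = - pCons 0 (act M a v)) \<and>
     (\<forall>a v. act M a (del M v) = map_poly (del M) (act M a v) + pCons 0 (act M a v)) \<and>
     (\<forall>a b v. act_lam_mu (act M) a b v = act_sum (act M) (br R a b) v + act_mu_lam (act M) a b v)"

definition adjoint_module :: "'r::ab_group_add lca \<Rightarrow> ('r, 'r) cmod" where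
  "adjoint_module R = \<lparr>scl = scl R, del = del R, act = br R\<rparr>"

text \<open>\<open>p(-\<lambda>-\<partial>)\<close> for \<open>p \<in> R[\<lambda>]\<close>, with \<open>\<partial>\<close> acting on the coefficients of \<open>p\<close>.\<close>

definition subst_skew :: "('r::ab_group_add, 'z) dmod_scheme \<Rightarrow> 'r poly \<Rightarrow> 'r poly" where
  "subst_skew R p =
     (\<Sum>i\<le>degree p. ((\<lambda>q. - pCons 0 q - map_poly (del R) q) ^^ i) [:coeff p i:])"

text \<open>
  Bilinearity, sesquilinearity and the Jacobi identity of the \<open>\<lambda>\<close>-bracket are literally the
  axioms of a conformal module for the bracket acting on the algebra itself.
\<close>

definition lie_conformal_algebra :: "'r::ab_group_add lca \<Rightarrow> bool" where
  "lie_conformal_algebra R \<longleftrightarrow>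
     conformal_module R (adjoint_module R) \<and>
     (\<forall>a b. br R a b = - subst_skew R (br R b a))"

section \<open>Extensions\<close>

definition conf_hom ::
  "('r, 'v::ab_group_add) cmod \<Rightarrow> ('r, 'w::ab_group_add) cmod \<Rightarrow> ('v \<Rightarrow> 'w) \<Rightarrow> bool" where
  "conf_hom M N \<phi> \<longleftrightarrow>
     Vector_Spaces.linear (scl M) (scl N) \<phi> \<and>
     (\<forall>v. \<phi> (del M v) = del N (\<phi> v)) \<and>
     (\<forall>a v. map_poly \<phi> (act M a v) = act N a (\<phi> v))"

text \<open>\<open>0 \<rightarrow> V \<rightarrow> E \<rightarrow> W \<rightarrow> 0\<close> with maps \<open>i\<close> and \<open>p\<close>.\<close>

definition extension ::
  "'r::ab_group_add lca \<Rightarrow> ('r, 'w::ab_group_add) cmod \<Rightarrow> ('r, 'v::ab_group_add) cmod \<Rightarrow>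
   ('r, 'e::ab_group_add) cmod \<Rightarrow> ('v \<Rightarrow> 'e) \<Rightarrow> ('e \<Rightarrow> 'w) \<Rightarrow> bool" where
  "extension R W V E i p \<longleftrightarrow>
     conformal_module R E \<and> conf_hom V E i \<and> conf_hom E W p \<and>
     inj i \<and> surj p \<and> range i = {x. p x = 0}"

definition equiv_ext ::
  "('r, 'e::ab_group_add) cmod \<Rightarrow> ('v \<Rightarrow> 'e) \<Rightarrow> ('e \<Rightarrow> 'w) \<Rightarrow>
   ('r, 'f::ab_group_add) cmod \<Rightarrow> ('v \<Rightarrow> 'f) \<Rightarrow> ('f \<Rightarrow> 'w) \<Rightarrow> bool" where
  "equiv_ext E i p E' i' p' \<longleftrightarrow>
     (\<exists>\<phi>. conf_hom E E' \<phi> \<and> (\<forall>v. \<phi> (i v) = i' v) \<and> (\<forall>x. p' (\<phi> x) = p x))"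

text \<open>
  The module structure on \<open>V \<oplus> W\<close> determined by a pair \<open>(\<psi>, h)\<close>:
  \<open>a\<^sub>\<lambda> w\<close> is replaced by \<open>\<psi>\<^sub>\<lambda>(a,w) + a\<^sub>\<lambda> w\<close>, and \<open>\<partial>w\<close> by \<open>h(w) + \<partial>w\<close>.  For \<open>\<psi> = 0\<close>, \<open>h = 0\<close>
  this is the direct sum.
\<close>

type_synonym ('r, 'w, 'v) cochain = "('r \<Rightarrow> 'w \<Rightarrow> 'v poly) \<times> ('w \<Rightarrow> 'v)"

definition twisted_sum ::
  "('r, 'w::ab_group_add) cmod \<Rightarrow> ('r, 'v::ab_group_add) cmod \<Rightarrow> ('r, 'w, 'v) cochain \<Rightarrow>
   ('r, 'v \<times> 'w) cmod" where
  "twisted_sum W V z =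
     \<lparr>scl = (\<lambda>k (v, w). (scl V k v, scl W k w)),
      del = (\<lambda>(v, w). (del V v + snd z w, del W w)),
      act = (\<lambda>a (v, w). map_poly (\<lambda>x. (x, 0)) (act V a v + fst z a w)
                      + map_poly (\<lambda>y. (0, y)) (act W a w))\<rparr>"

definition zero_cochain :: "('r, 'w, 'v::ab_group_add) cochain" where
  "zero_cochain = (\<lambda>a w. 0, \<lambda>w. 0)"

definition direct_sum ::
  "('r, 'w::ab_group_add) cmod \<Rightarrow> ('r, 'v::ab_group_add) cmod \<Rightarrow> ('r, 'v \<times> 'w) cmod" where
  "direct_sum W V = twisted_sum W V zero_cochain"

definition trivial_ext ::
  "('r, 'w::ab_group_add) cmod \<Rightarrow> ('r, 'v::ab_group_add) cmod \<Rightarrow>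
   ('r, 'e::ab_group_add) cmod \<Rightarrow> ('v \<Rightarrow> 'e) \<Rightarrow> ('e \<Rightarrow> 'w) \<Rightarrow> bool" where
  "trivial_ext W V E i p \<longleftrightarrow> equiv_ext E i p (direct_sum W V) (\<lambda>v. (v, 0)) snd"

section \<open>\<open>Ext\<close>\<close>

text \<open>
  An extension cocycle is a pair \<open>(\<psi>, h)\<close> for which the twisted sum is a conformal module;
  it is then an extension of \<open>W\<close> by \<open>V\<close> with the evident maps.  Since the cocycles
  only form a subset of the type of cochains, \<open>Ext\<close> is a carrier-based vector space: the
  quotient of the space of cocycles by the cocycles of trivial extensions.
\<close>

definition cocycles ::
  "'r::ab_group_add lca \<Rightarrow> ('r, 'w::ab_group_add) cmod \<Rightarrow> ('r, 'v::ab_group_add) cmod \<Rightarrow>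
   ('r, 'w, 'v) cochain set" where
  "cocycles R W V = {z. conformal_module R (twisted_sum W V z)}"

definition trivial_cocycles ::
  "'r::ab_group_add lca \<Rightarrow> ('r, 'w::ab_group_add) cmod \<Rightarrow> ('r, 'v::ab_group_add) cmod \<Rightarrow>
   ('r, 'w, 'v) cochain set" where
  "trivial_cocycles R W V =
     {z \<in> cocycles R W V. trivial_ext W V (twisted_sum W V z) (\<lambda>v. (v, 0)) snd}"

text \<open>The fields \<open>mult\<close> and \<open>one\<close> of the record \<open>module\<close> are irrelevant for vector spaces.\<close>

definition cocycle_space ::
  "'r::ab_group_add lca \<Rightarrow> ('r, 'w::ab_group_add) cmod \<Rightarrow> ('r, 'v::ab_group_add) cmod \<Rightarrow>
   (complex, ('r, 'w, 'v) cochain) module" where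
  "cocycle_space R W V =
     \<lparr>carrier = cocycles R W V, mult = undefined, one = undefined,
      zero = zero_cochain,
      add = (\<lambda>(\<psi>, h) (\<psi>', h'). (\<lambda>a w. \<psi> a w + \<psi>' a w, \<lambda>w. h w + h' w)),
      smult = (\<lambda>k (\<psi>, h). (\<lambda>a w. map_poly (scl V k) (\<psi> a w), \<lambda>w. scl V k (h w)))\<rparr>"

definition Ext ::
  "'r::ab_group_add lca \<Rightarrow> ('r, 'w::ab_group_add) cmod \<Rightarrow> ('r, 'v::ab_group_add) cmod \<Rightarrow>
   (complex, ('r, 'w, 'v) cochain set) module" where
  "Ext R W V =
     (let Z = cocycle_space R W V; T = trivial_cocycles R W V in
     \<lparr>carrier = A_RCOSETS Z T, mult = undefined, one = undefined,
      zero = T,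
      add = set_add Z,
      smult = (\<lambda>k X. \<Union>z\<in>X. a_r_coset Z T (k \<odot>\<^bsub>Z\<^esub> z))\<rparr>)"

text \<open>\<open>vectorspace.dim\<close> is a least cardinality, hence meaningful only for finite-dimensional spaces.\<close>

definition has_dim :: "(complex, 'c) module \<Rightarrow> nat \<Rightarrow> bool" where
  "has_dim X n \<longleftrightarrow> vectorspace class_ring X \<and> vectorspace.fin_dim class_ring X
                   \<and> vectorspace.dim class_ring X = n"

section \<open>Rank two algebras of Type II and their modules\<close>

inductive typeII_poly :: "complex \<Rightarrow> complex poly poly \<Rightarrow> bool" where
  "typeII_poly 1 (cnst c * (dvar + 2 * lvar))"
| "typeII_poly 0 (cnst c * (dvar + 2 * lvar) * (dvar + lvar) * lvar
                + cnst d * (dvar + 2 * lvar) * dvar)"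
| "typeII_poly (-1) (cnst c * (dvar + 2 * lvar) * dvar ^ 2
                   + cnst d * (dvar + 2 * lvar) * (dvar + lvar) * dvar * lvar)"
| "typeII_poly (-4) (cnst c * (dvar + 2 * lvar) * (dvar + lvar) ^ 3 * lvar ^ 3)"
| "typeII_poly (-6) (cnst c * (dvar + 2 * lvar) *
      (11 * (dvar + lvar) ^ 4 * lvar ^ 4 + 2 * (dvar + lvar) ^ 3 * dvar ^ 2 * lvar ^ 3))"

definition typeII_lca ::
  "'r::ab_group_add lca \<Rightarrow> 'r \<Rightarrow> 'r \<Rightarrow> complex \<Rightarrow> complex poly poly \<Rightarrow> bool" where
  "typeII_lca R A B a Q \<longleftrightarrow>
     lie_conformal_algebra R \<and>
     bij (\<lambda>(x, y). pact R x A + pact R y B) \<and>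
     typeII_poly a Q \<and>
     br R A A = pact2 R (dvar + 2 * lvar) A + pact2 R Q B \<and>
     br R A B = pact2 R (dvar + cnst a * lvar) B \<and>
     br R B B = 0"

text \<open>\<open>V\<close> is \<open>V\<^sub>\<alpha>\<^sub>,\<^sub>\<beta>\<close> with free generator \<open>v\<close>.\<close>

definition rank_one_module ::
  "'r::ab_group_add lca \<Rightarrow> 'r \<Rightarrow> 'r \<Rightarrow> complex \<Rightarrow> complex \<Rightarrow> ('r, 'v::ab_group_add) cmod \<Rightarrow> 'v \<Rightarrow> bool"
where
  "rank_one_module R A B \<alpha> \<beta> V v \<longleftrightarrow>
     conformal_module R V \<and>
     bij (\<lambda>x. pact V x v) \<and>
     act V A v = pact2 V (dvar + cnst \<alpha> * lvar + cnst \<beta>) v \<and>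
     act V B v = 0"

text \<open>The module \<open>\<complex>c\<^sub>\<eta>\<close>, with \<open>c\<^sub>\<eta> = 1\<close>.\<close>

definition one_dim_module :: "complex \<Rightarrow> ('r, complex) cmod" where
  "one_dim_module \<eta> = \<lparr>scl = (*), del = (\<lambda>x. \<eta> * x), act = (\<lambda>a x. 0)\<rparr>"

text \<open>
  The shape of an extension \<open>E\<close> of \<open>\<complex>c\<^sub>\<eta>\<close> by \<open>V\<^sub>\<alpha>\<^sub>,\<^sub>\<beta>\<close> with respect to a lift \<open>c \<in> E\<close> of \<open>c\<^sub>\<eta>\<close>;
  \<open>v\<close> is identified with \<open>i v\<close>.
\<close>

definition ext_shape ::
  "'r \<Rightarrow> 'r \<Rightarrow> complex \<Rightarrow> complex \<Rightarrow> complex \<Rightarrow> 'v \<Rightarrow>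
   ('r, 'e::ab_group_add) cmod \<Rightarrow> ('v \<Rightarrow> 'e) \<Rightarrow> ('e \<Rightarrow> complex) \<Rightarrow> 'e \<Rightarrow>
   complex poly poly \<Rightarrow> complex poly poly \<Rightarrow> complex poly \<Rightarrow> bool" where
  "ext_shape A B \<alpha> \<beta> \<eta> v E i p c f g h \<longleftrightarrow>
     p c = 1 \<and>
     bij (\<lambda>(x, k). pact E x (i v) + scl E k c) \<and>
     act E A (i v) = pact2 E (dvar + cnst \<alpha> * lvar + cnst \<beta>) (i v) \<and>
     act E B (i v) = 0 \<and>
     act E A c = pact2 E f (i v) \<and>
     act E B c = pact2 E g (i v) \<and>
     del E c = scl E \<eta> c + pact E h (i v)"

end

theory Submission
  imports Defs
begin

text \<open>
  Put \<open>T = \<partial> - \<eta>\<close>.  The sesquilinearity axiom says \<open>a\<^sub>\<lambda>(T x) = (T + \<lambda>)(a\<^sub>\<lambda> x)\<close>, and the operator \<open>T + \<lambda>\<close> on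
  polynomials in \<open>\<lambda>\<close> is injective, because it moves the leading coefficient one degree up
  (\<open>shift_eq_0\<close>).

  Let \<open>c\<close> be a lift of \<open>c\<^sub>\<eta>\<close> to an extension \<open>E\<close>.  As \<open>T\<close> annihilates \<open>c\<^sub>\<eta>\<close>, the vector \<open>w = T c\<close> lies in \<open>V\<close>, and
  \<open>(T + \<lambda>)(a\<^sub>\<lambda> c) = a\<^sub>\<lambda> w\<close>.  So \<open>w\<close> alone determines \<open>a\<^sub>\<lambda> c\<close> for every \<open>a\<close>, hence the extension
  (\<open>equiv_twisted_sum\<close>).  Conversely, if \<open>w \<in> V\<close> is such that \<open>a\<^sub>\<lambda> w\<close> is divisible by \<open>T + \<lambda>\<close> for every \<open>a\<close>, then
  the quotients define an extension (\<open>conformal_twisted_sum\<close>): they depend on \<open>a\<close> as \<open>a\<^sub>\<lambda> w\<close> does because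
  division is unique, and the Jacobi identity at \<open>x \<in> E\<close> follows from the one at \<open>T x \<in> V\<close> by cancelling
  \<open>T + \<lambda> + \<mu>\<close>.  Replacing \<open>c\<close> by \<open>c - u\<close> with \<open>u \<in> V\<close>
  replaces \<open>w\<close> by \<open>w - T u\<close>, and the extension is trivial iff \<open>w \<in> T V\<close> (\<open>trivial_ext_iff\<close>).  Thus
  \<open>Ext\<close> is the space of all \<open>w\<close> with divisible action, modulo \<open>T V\<close>.

  For \<open>V = \<complex>[\<partial>]v\<close> the quotient \<open>V/T V\<close> is a line, spanned by the class of \<open>v\<close>, the coordinate being
  \<open>h(\<partial>)v \<mapsto> h(\<eta>)\<close>.  It remains to decide whether \<open>v\<close> has divisible action.  The polynomial
  \<open>A\<^sub>\<lambda> v = (\<partial> + \<alpha>\<lambda> + \<beta>)v\<close> is of degree at most one in \<open>\<lambda>\<close>, so it is divisible by \<open>\<partial> - \<eta> + \<lambda>\<close> only if it equals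
  \<open>(\<partial> - \<eta> + \<lambda>)\<alpha>v\<close>, that is, if \<open>\<alpha> = 1\<close> and \<open>\<beta> = -\<eta>\<close> (\<open>generator_obstruction\<close>).  In that case the quotient
  is \<open>v\<close> itself, \<open>B\<close> acts by zero, and \<open>A\<close>, \<open>B\<close> generate the algebra, so the action is divisible
  (\<open>divisible\<close>).  For \<open>w = s v\<close> this reads \<open>f = h = s\<close>, \<open>g = 0\<close> (\<open>constant_cocycle\<close>).
\<close>

section \<open>The operator \<open>T + \<lambda>\<close>\<close>

definition shift :: "('v::ab_group_add \<Rightarrow> 'v) \<Rightarrow> 'v poly \<Rightarrow> 'v poly" where
  "shift T q = map_poly T q + pCons 0 q"

lemma coeff_map_poly_additive:
  "Modules.additive f \<Longrightarrow> coeff (map_poly f q) n = f (coeff q n)"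
  by (simp add: coeff_map_poly Modules.additive.zero)

lemma additive_map_poly: "Modules.additive f \<Longrightarrow> Modules.additive (map_poly f)"
  by (intro Modules.additive.intro poly_eqI)
     (simp add: coeff_map_poly_additive Modules.additive.add)

lemma additive_pCons_0: "Modules.additive (pCons (0::'v::ab_group_add))"
  by (simp add: Modules.additive_def)

lemma coeff_shift:
  "Modules.additive T \<Longrightarrow>
     coeff (shift T q) n = T (coeff q n) + (case n of 0 \<Rightarrow> 0 | Suc m \<Rightarrow> coeff q m)"
  by (simp add: shift_def coeff_map_poly_additive coeff_pCons)

lemma additive_shift: "Modules.additive T \<Longrightarrow> Modules.additive (shift T)"
  by (intro Modules.additive.intro) (simp add: shift_def Modules.additive.add[OF additive_map_poly])

text \<open>
  The operator \<open>T + \<lambda>\<close> carries the leading coefficient of \<open>q\<close> unchanged into the next degree.  The lemma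
  serves for polynomials in \<open>\<lambda>\<close> over \<open>V\<close> and, with \<open>shift T\<close> in place of \<open>T\<close>, for polynomials in \<open>\<mu>\<close> over \<open>V[\<lambda>]\<close>.
\<close>

lemma shift_eq_0:
  assumes T: "Modules.additive T" and "shift T q = 0"
  shows "q = 0"
proof -
  have "coeff (shift T q) (Suc (degree q)) = lead_coeff q"
    by (simp add: coeff_shift[OF T] coeff_eq_0 Modules.additive.zero[OF T])
  with assms(2) show ?thesis by simp
qed

lemma shift_inj: "Modules.additive T \<Longrightarrow> shift T p = shift T q \<Longrightarrow> p = q"
  using shift_eq_0[of T "p - q"] Modules.additive.diff[OF additive_shift] by fastforce

lemma map_poly_comp_additive:
  "Modules.additive f \<Longrightarrow> Modules.additive g \<Longrightarrow> map_poly f (map_poly g q) = map_poly (\<lambda>x. f (g x)) q"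
  by (intro poly_eqI) (simp add: coeff_map_poly Modules.additive.zero)

lemma map_poly_shift:
  assumes "Modules.additive f" "Modules.additive T" "Modules.additive U" and "\<And>x. f (T x) = U (f x)"
  shows "map_poly f (shift T q) = shift U (map_poly f q)"
  using assms by (intro poly_eqI)
    (simp add: coeff_map_poly_additive coeff_shift Modules.additive.add Modules.additive.zero split: nat.split)

section \<open>The three terms of the Jacobi identity\<close>

lemma coeff_mult_lam:
  "coeff (mult_lam q) n = pCons 0 (coeff q n)"
  by (simp add: mult_lam_def coeff_map_poly)

lemma additive_mult_lam: "Modules.additive mult_lam"
  unfolding mult_lam_def by (intro additive_map_poly additive_pCons_0)

lemma additive_mult_lam_mu: "Modules.additive mult_lam_mu"
  by (simp add: Modules.additive_def mult_lam_mu_def Modules.additive.add[OF additive_mult_lam])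

lemma additive_funpow:
  fixes f :: "'v::ab_group_add \<Rightarrow> 'v"
  shows "Modules.additive f \<Longrightarrow> Modules.additive (f ^^ n)"
  by (induction n) (auto simp: Modules.additive_def)

text \<open>
  The defining sum of \<open>subst_lam_mu\<close> stops at the degree, which varies under addition; summing up to a
  common bound makes additivity and the recursion over \<open>pCons\<close> visible.
\<close>

lemma subst_lam_mu_eq_sum:
  assumes "degree p \<le> N"
  shows "subst_lam_mu p = (\<Sum>i\<le>N. (mult_lam_mu ^^ i) [:[:coeff p i:]:])"
proof -
  have "(mult_lam_mu ^^ i) 0 = (0::'a poly poly)" for i
    by (intro Modules.additive.zero additive_funpow additive_mult_lam_mu)
  then show ?thesis unfolding subst_lam_mu_def using assms
    by (intro sum.mono_neutral_left) (auto simp: coeff_eq_0)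
qed

lemma subst_lam_mu_pCons:
  "subst_lam_mu (pCons c p) = [:[:c:]:] + mult_lam_mu (subst_lam_mu p)"
  by (simp add: subst_lam_mu_eq_sum[of "pCons c p" "Suc (degree p)"] degree_pCons_le
      subst_lam_mu_eq_sum[of p "degree p"] sum.atMost_Suc_shift Modules.additive.sum[OF additive_mult_lam_mu]
      del: sum.atMost_Suc)

lemma subst_lam_mu_0: "subst_lam_mu 0 = 0"
  by (simp add: subst_lam_mu_def)

lemma additive_subst_lam_mu: "Modules.additive subst_lam_mu"
proof
  fix p q :: "'a poly"
  define N where "N = max (degree p) (degree q)"
  have "degree p \<le> N" "degree q \<le> N" "degree (p + q) \<le> N"
    by (auto simp: N_def degree_add_le)
  moreover have "(mult_lam_mu ^^ i) ([:[:x + y:]:]) = (mult_lam_mu ^^ i) [:[:x:]:] + (mult_lam_mu ^^ i) [:[:y:]:]"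
    for i and x y :: 'a
    using Modules.additive.add[OF additive_funpow[OF additive_mult_lam_mu], of i "[:[:x:]:]" "[:[:y:]:]"] by simp
  ultimately show "subst_lam_mu (p + q) = subst_lam_mu p + subst_lam_mu q"
    by (simp add: subst_lam_mu_eq_sum[of _ N] sum.distrib)
qed

lemma mult_lam_map_map:
  "Modules.additive f \<Longrightarrow> mult_lam (map_poly (map_poly f) q) = map_poly (map_poly f) (mult_lam q)"
  by (intro poly_eqI)
     (simp add: coeff_mult_lam coeff_map_poly coeff_pCons Modules.additive.zero split: nat.split)

lemma mult_lam_mu_map_map:
  assumes f: "Modules.additive f"
  shows "mult_lam_mu (map_poly (map_poly f) q) = map_poly (map_poly f) (mult_lam_mu q)"
proof -
  have "map_poly (map_poly f) (pCons 0 q) = pCons 0 (map_poly (map_poly f) q)"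
    by (simp add: map_poly_pCons)
  then show ?thesis
    by (simp add: mult_lam_mu_def mult_lam_map_map f
      Modules.additive.add[OF additive_map_poly[OF additive_map_poly[OF f]]])
qed

lemma subst_lam_mu_map:
  assumes f: "Modules.additive f"
  shows "subst_lam_mu (map_poly f q) = map_poly (map_poly f) (subst_lam_mu q)"
proof (induction q)
  case 0
  then show ?case by (simp add: subst_lam_mu_0)
next
  case (pCons c q)
  then show ?case
    by (simp add: map_poly_pCons Modules.additive.zero[OF f] subst_lam_mu_pCons mult_lam_mu_map_map[OF f]
        Modules.additive.add[OF additive_map_poly[OF additive_map_poly[OF f]]])
qed

text \<open>
  On \<open>V[\<lambda>][\<mu>]\<close> the iterated shift is \<open>T + \<lambda> + \<mu>\<close>: the inner shift acts on coefficients as \<open>T + \<lambda>\<close>,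
  the outer one adds \<open>\<mu>\<close>.
\<close>

lemma shift_shift_eq:
  assumes "Modules.additive T"
  shows "shift (shift T) q = map_poly (map_poly T) q + mult_lam_mu q"
  using assms
  by (intro poly_eqI) (simp add: coeff_shift additive_shift mult_lam_mu_def coeff_mult_lam
     coeff_map_poly Modules.additive.zero  coeff_pCons split: nat.split)

lemma subst_lam_mu_shift:
  assumes "Modules.additive T"
  shows "subst_lam_mu (shift T q) = shift (shift T) (subst_lam_mu q)"
proof -
  have "subst_lam_mu (pCons 0 q) = mult_lam_mu (subst_lam_mu q)"
    by (simp add: subst_lam_mu_pCons)
  then show ?thesis
    by (simp add: shift_shift_eq assms shift_def[of T] Modules.additive.add[OF additive_subst_lam_mu]
       subst_lam_mu_map)
qed

lemma mult_lam_shift_shift: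
  assumes T: "Modules.additive T"
  shows "mult_lam (shift (shift T) q) = shift (shift T) (mult_lam q)"
  unfolding mult_lam_def
  by (intro map_poly_shift additive_pCons_0 additive_shift T)
     (simp add: shift_def map_poly_pCons Modules.additive.zero[OF T])

lemma coeff_swap_vars: "coeff (coeff (swap_vars q) m) n = coeff (coeff q n) m"
proof -
  have "coeff (coeff (swap_vars q) m) n = (\<Sum>i\<le>degree q. if i = n then coeff (coeff q i) m else 0)"
    unfolding swap_vars_def by (simp add: coeff_sum coeff_map_poly if_distrib cong: if_cong)
  also have "\<dots> = coeff (coeff q n) m"
    by (auto simp: coeff_eq_0)
  finally show ?thesis .
qed

lemma swap_vars_shift_shift:
  assumes "Modules.additive T"
  shows "swap_vars (shift (shift T) q) = shift (shift T) (swap_vars q)"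
  using assms
  by (intro poly_eqI) (simp add: coeff_swap_vars coeff_shift additive_shift split: nat.split)

lemma swap_vars_map_map:
  assumes "Modules.additive f"
  shows "swap_vars (map_poly (map_poly f) q) = map_poly (map_poly f) (swap_vars q)"
  using assms
  by (intro poly_eqI) (simp add: coeff_swap_vars coeff_map_poly Modules.additive.zero)

section \<open>The Jacobi identity under intertwining maps\<close>

definition jacobiator ::
  "('r \<Rightarrow> 'v \<Rightarrow> 'v poly) \<Rightarrow> 'r::ab_group_add poly \<Rightarrow> 'r \<Rightarrow> 'r \<Rightarrow> 'v::ab_group_add \<Rightarrow> 'v poly poly" where
  "jacobiator \<rho> p a b v = act_lam_mu \<rho> a b v - (act_sum \<rho> p v + act_mu_lam \<rho> a b v)"

text \<open>
  The Jacobi identity is sesquilinear in its last argument: each of its three terms turns \<open>T\<close> into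
  \<open>T + \<lambda> + \<mu>\<close>.  Since that operator is injective, the identity at \<open>x\<close> follows from the identity at \<open>T x\<close>.
\<close>

lemma jacobiator_shift:
  assumes T: "Modules.additive T" and \<rho>: "\<And>a. Modules.additive (\<rho> a)"
    and comm: "\<And>a x. \<rho> a (T x) = shift T (\<rho> a x)"
  shows "jacobiator \<rho> p a b (T x) = shift (shift T) (jacobiator \<rho> p a b x)"
proof -
  note TT = additive_shift[OF additive_shift[OF T]]
  have two: "map_poly (\<rho> a) (\<rho> b (T x)) = shift (shift T) (map_poly (\<rho> a) (\<rho> b x))" for a b
    by (simp add: comm map_poly_shift[OF \<rho> T additive_shift[OF T]])
  have "(mult_lam ^^ i) (shift (shift T) q) = shift (shift T) ((mult_lam ^^ i) q)" for i q
    by (induction i) (simp_all add: mult_lam_shift_shift[OF T])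
  then have "act_sum \<rho> p (T x) = shift (shift T) (act_sum \<rho> p x)"
    by (simp add: act_sum_def comm subst_lam_mu_shift[OF T] Modules.additive.sum[OF TT])
  then show ?thesis
    by (simp add: jacobiator_def act_lam_mu_def act_mu_lam_def two swap_vars_shift_shift[OF T]
        Modules.additive.add[OF TT] Modules.additive.diff[OF TT])
qed

text \<open>
  Naturality of the Jacobi identity; it carries the identity from a submodule \<open>V\<close> to its image in an
  extension.
\<close>

lemma jacobiator_map:
  assumes f: "Modules.additive f" and \<rho>: "\<And>a. Modules.additive (\<rho> a)" and \<sigma>: "\<And>a. Modules.additive (\<sigma> a)"
    and comm: "\<And>a x. \<sigma> a (f x) = map_poly f (\<rho> a x)"
  shows "jacobiator \<sigma> p a b (f x) = map_poly (map_poly f) (jacobiator \<rho> p a b x)"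
proof -
  note ff = additive_map_poly[OF additive_map_poly[OF f]]
  have two: "map_poly (\<sigma> a) (\<sigma> b (f x)) = map_poly (map_poly f) (map_poly (\<rho> a) (\<rho> b x))" for a b
    by (simp add: comm map_poly_comp_additive additive_map_poly f \<rho> \<sigma>)
  have "(mult_lam ^^ i) (map_poly (map_poly f) q) = map_poly (map_poly f) ((mult_lam ^^ i) q)" for i q
    by (induction i) (simp_all add: mult_lam_map_map[OF f])
  then have "act_sum \<sigma> p (f x) = map_poly (map_poly f) (act_sum \<rho> p x)"
    by (simp add: act_sum_def comm subst_lam_mu_map[OF f] Modules.additive.sum[OF ff])
  then show ?thesis
    by (simp add: jacobiator_def act_lam_mu_def act_mu_lam_def two swap_vars_map_map[OF f]
        Modules.additive.add[OF ff] Modules.additive.diff[OF ff])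
qed

lemma vector_space_map_poly:
  assumes "vector_space s"
  shows "vector_space (\<lambda>k. map_poly (s k))"
proof -
  interpret vector_space s by fact
  show ?thesis
    by unfold_locales
       (auto intro!: poly_eqI simp: coeff_map_poly scale_right_distrib scale_left_distrib)
qed

section \<open>Conformal modules and the operator \<open>\<partial> - \<eta>\<close>\<close>

text \<open>
  The operator \<open>\<partial> - \<eta>\<close>.  It annihilates \<open>\<complex>c\<^sub>\<eta>\<close>, so it maps every extension of \<open>\<complex>c\<^sub>\<eta>\<close>
  by \<open>V\<close> into \<open>V\<close>.
\<close>

definition del_minus :: "('v::ab_group_add, 'z) dmod_scheme \<Rightarrow> complex \<Rightarrow> 'v \<Rightarrow> 'v" where
  "del_minus M \<eta> x = del M x - scl M \<eta> x"

text \<open>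
  The axioms of a conformal module except for the Jacobi identity.  They are separated because, for an
  extension, they are what is needed to derive the Jacobi identity by cancelling \<open>\<partial> - \<eta> + \<lambda> + \<mu>\<close>.
\<close>

locale sesqui_mod =
  fixes R :: "'r::ab_group_add lca" and M :: "('r, 'v::ab_group_add) cmod"
  assumes vsR: "vector_space (scl R)"
    and vs: "vector_space (scl M)"
    and del_add: "del M (x + y) = del M x + del M y"
    and del_scl: "del M (scl M k x) = scl M k (del M x)"
    and act_add_left: "act M (a + b) x = act M a x + act M b x"
    and act_scl_left: "act M (scl R k a) x = map_poly (scl M k) (act M a x)"
    and act_add: "act M a (x + y) = act M a x + act M a y"
    and act_scl: "act M a (scl M k x) = map_poly (scl M k) (act M a x)"
    and act_del_left: "act M (del R a) x = - pCons 0 (act M a x)"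
    and act_del: "act M a (del M x) = shift (del M) (act M a x)"
begin

sublocale V: vector_space "scl M" by (rule vs)

lemma additive_scl: "Modules.additive (scl M k)"
  by (simp add: Modules.additive_def V.scale_right_distrib)

lemma additive_act: "Modules.additive (act M a)"
  by (simp add: Modules.additive_def act_add)

lemma additive_del: "Modules.additive (del M)"
  by (simp add: Modules.additive_def del_add)

lemma additive_del_minus: "Modules.additive (del_minus M \<eta>)"
  by (simp add: Modules.additive_def del_minus_def del_add V.scale_right_distrib)

lemma del_minus_scl: "del_minus M \<eta> (scl M k x) = scl M k (del_minus M \<eta> x)"
  by (simp add: del_minus_def del_scl V.scale_right_diff_distrib mult.commute)

lemma shift_scl:
  "shift (del_minus M \<eta>) (map_poly (scl M k) q) = map_poly (scl M k) (shift (del_minus M \<eta>) q)"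
  by (rule map_poly_shift[symmetric]) (simp_all add: additive_scl additive_del_minus del_minus_scl)

lemma shift_del_minus: "shift (del_minus M \<eta>) q = shift (del M) q - map_poly (scl M \<eta>) q"
  by (rule poly_eqI)
     (simp add: coeff_shift additive_del_minus additive_del coeff_map_poly_additive additive_scl,
      simp add: del_minus_def)

text \<open>
  The scalar \<open>\<eta>\<close> commutes with the action, so the sesquilinearity axiom for \<open>\<partial>\<close> shifts to \<open>\<partial> - \<eta>\<close>.
\<close>

lemma act_del_minus: "act M a (del_minus M \<eta> x) = shift (del_minus M \<eta>) (act M a x)"
  by (simp add: shift_del_minus del_minus_def Modules.additive.diff[OF additive_act] act_del act_scl)

lemma shift_eqD: "shift (del_minus M \<eta>) p = shift (del_minus M \<eta>) q \<Longrightarrow> p = q"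
  by (rule shift_inj[OF additive_del_minus])

lemma jacobiator_del_minus:
  "jacobiator (act M) p a b (del_minus M \<eta> x) =
     shift (shift (del_minus M \<eta>)) (jacobiator (act M) p a b x)"
  by (rule jacobiator_shift[OF additive_del_minus additive_act act_del_minus])

end

locale conf_mod = sesqui_mod +
  assumes jacobiator_0: "jacobiator (act M) (br R a b) a b x = 0"

lemma conformal_module_iff: "conformal_module R M \<longleftrightarrow> conf_mod R M"
  unfolding conformal_module_def is_dmod_def Vector_Spaces.linear_iff shift_def jacobiator_def
    conf_mod_def sesqui_mod_def conf_mod_axioms_def
  by (auto intro: vector_space_map_poly)

section \<open>Cocycles of extensions of \<open>\<complex>c\<^sub>\<eta>\<close>\<close>

lemma additive_inl: "Modules.additive (\<lambda>x::'v::ab_group_add. (x, 0::'w::ab_group_add))"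
  by (simp add: Modules.additive_def)

abbreviation inl :: "'v \<Rightarrow> 'v \<times> complex" where "inl \<equiv> \<lambda>x. (x, 0)"

lemma twisted_sum_sel:
  "scl (twisted_sum (one_dim_module \<eta>) V z) k (x, l) = (scl V k x, k * l)"
  "del (twisted_sum (one_dim_module \<eta>) V z) (x, l) = (del V x + snd z l, \<eta> * l)"
  "act (twisted_sum (one_dim_module \<eta>) V z) a (x, l) = map_poly inl (act V a x + fst z a l)"
  by (simp_all add: twisted_sum_def one_dim_module_def)

definition cochain :: "('r, 'v::ab_group_add) cmod \<Rightarrow> ('r \<Rightarrow> 'v poly) \<Rightarrow> 'v \<Rightarrow> ('r, complex, 'v) cochain" where
  "cochain V \<psi> w = (\<lambda>a k. map_poly (scl V k) (\<psi> a), \<lambda>k. scl V k w)"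

text \<open>
  An element \<open>w\<close> gives an extension as soon as every \<open>a\<^sub>\<lambda> w\<close> can be divided by \<open>\<partial> - \<eta> + \<lambda>\<close>.
  The quotient \<open>\<psi> a\<close> is to be \<open>a\<^sub>\<lambda> c\<close> for a vector \<open>c\<close> with \<open>(\<partial> - \<eta>)c = w\<close>.  Division is unique, so \<open>\<psi>\<close>
  inherits linearity and \<open>\<psi>(\<partial>a) = -\<lambda>\<psi>(a)\<close> from \<open>a\<^sub>\<lambda> w\<close>.  The Jacobi identity on the twisted sum holds
  because \<open>\<partial> - \<eta>\<close> maps the twisted sum into \<open>V\<close>, where it is known.
\<close>

lemma (in conf_mod) conformal_twisted_sum:
  assumes \<psi>: "\<And>a. shift (del_minus M \<eta>) (\<psi> a) = act M a w"
  shows "conformal_module R (twisted_sum (one_dim_module \<eta>) M (cochain M \<psi> w))"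
    (is "conformal_module R ?E")
proof -
  have scl: "scl ?E k (x, l) = (scl M k x, k * l)"
    and del: "del ?E (x, l) = (del M x + scl M l w, \<eta> * l)"
    and act: "act ?E a (x, l) = map_poly inl (act M a x + map_poly (scl M l) (\<psi> a))" for k x l a
    by (simp_all add: twisted_sum_sel cochain_def)
  note [simp] = Modules.additive.add[OF additive_shift[OF additive_del_minus]]
    Modules.additive.add[OF additive_map_poly[OF additive_scl]]
    Modules.additive.minus[OF additive_map_poly[OF additive_scl]]
    Modules.additive.add[OF additive_map_poly[OF additive_inl]]
    Modules.additive.minus[OF additive_map_poly[OF additive_inl]]
  interpret P: vector_space "\<lambda>k. map_poly (scl M k)" by (rule vector_space_map_poly[OF vs])
  have \<psi>_add: "\<psi> (a + b) = \<psi> a + \<psi> b" for a b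
    by (rule shift_eqD[of \<eta>]) (simp add: \<psi> act_add_left)
  have \<psi>_scl: "\<psi> (scl R k a) = map_poly (scl M k) (\<psi> a)" for k a
    by (rule shift_eqD[of \<eta>]) (simp add: \<psi> act_scl_left shift_scl)
  have "shift (del_minus M \<eta>) (pCons 0 q) = pCons 0 (shift (del_minus M \<eta>) q)" for q
    by (simp add: shift_def map_poly_pCons Modules.additive.zero[OF additive_del_minus])
  then have shift_pCons: "shift (del_minus M \<eta>) (- pCons 0 q) = - pCons 0 (shift (del_minus M \<eta>) q)" for q
    by (simp only: Modules.additive.minus[OF additive_shift[OF additive_del_minus]])
  have \<psi>_del: "\<psi> (del R a) = - pCons 0 (\<psi> a)" for a
    by (rule shift_eqD[of \<eta>]) (simp only: \<psi> act_del_left shift_pCons)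
  have \<psi>_shift: "act M a w + map_poly (scl M \<eta>) (\<psi> a) = shift (del M) (\<psi> a)" for a
    by (simp add: \<psi>[symmetric] shift_del_minus)
  have inl_scl: "map_poly inl (map_poly (scl M k) q) = map_poly (scl ?E k) (map_poly inl q)" for k q
    by (intro poly_eqI) (simp add: coeff_map_poly scl Modules.additive.zero[OF additive_scl] zero_prod_def)
  have vsE: "vector_space (scl ?E)"
    by unfold_locales (auto simp: scl V.scale_right_distrib V.scale_left_distrib algebra_simps)
  have delE_add: "del ?E (x + y) = del ?E x + del ?E y" for x y
    by (cases x; cases y) (simp add: del del_add V.scale_left_distrib algebra_simps)
  have delE_scl: "del ?E (scl ?E k x) = scl ?E k (del ?E x)" for k x
    by (cases x) (simp add: del scl del_scl V.scale_right_distrib algebra_simps)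
  have actE_add: "act ?E a (x + y) = act ?E a x + act ?E a y" for a x y
    by (cases x; cases y) (simp add: act act_add P.scale_left_distrib algebra_simps)
  have inl_shift: "map_poly inl (shift (del M) q) = shift (del ?E) (map_poly inl q)" for q
    by (intro map_poly_shift additive_inl additive_del)
       (simp_all add: del Modules.additive_def delE_add)
  have actE_del: "act ?E a (del ?E x) = shift (del ?E) (act ?E a x)" for a x
  proof -
    obtain y l where x: "x = (y, l)" by force
    have "act M a (del M y + scl M l w) + map_poly (scl M (\<eta> * l)) (\<psi> a)
        = shift (del M) (act M a y) + map_poly (scl M l) (act M a w + map_poly (scl M \<eta>) (\<psi> a))"
      by (simp add: act_add act_scl act_del algebra_simps)
    also have "\<dots> = shift (del M) (act M a y + map_poly (scl M l) (\<psi> a))"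
      unfolding \<psi>_shift
      by (simp add: Modules.additive.add[OF additive_shift[OF additive_del]]
           map_poly_shift[OF additive_scl additive_del additive_del] del_scl)
    finally show ?thesis by (simp only: x del act inl_shift)
  qed
  have actE_scl: "act ?E a (scl ?E k x) = map_poly (scl ?E k) (act ?E a x)" for a k x
    by (cases x) (simp only: scl act act_scl inl_scl[symmetric], simp)
  have "act ?E (a + b) x = act ?E a x + act ?E b x" for a b x
    by (cases x) (simp add: act act_add_left \<psi>_add)
  moreover have "act ?E (scl R k a) x = map_poly (scl ?E k) (act ?E a x)" for k a x
    by (cases x) (simp only: act act_scl_left \<psi>_scl inl_scl[symmetric], simp add: mult.commute)
  moreover have "act ?E (del R a) x = - pCons 0 (act ?E a x)" for a x
  proof (cases x)
    case (Pair y l)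
    have "act M (del R a) y + map_poly (scl M l) (\<psi> (del R a)) = - pCons 0 (act M a y + map_poly (scl M l) (\<psi> a))"
      by (simp only: act_del_left \<psi>_del Modules.additive.minus[OF additive_map_poly[OF additive_scl]]
          map_poly_pCons Modules.additive.zero[OF additive_scl] add_pCons add_0 flip: minus_add_distrib)
    then show ?thesis
      by (simp only: Pair act Modules.additive.minus[OF additive_map_poly[OF additive_inl]]
          map_poly_pCons Modules.additive.zero[OF additive_inl])
  qed
  ultimately interpret E: sesqui_mod R ?E
    by unfold_locales (use vsR vsE delE_add delE_scl actE_add actE_scl actE_del in \<open>auto simp: vector_space_def\<close>)
  have "jacobiator (act ?E) (br R a b) a b x = 0" for a b x
  proof -
    obtain y l where x: "x = (y, l)" by force
    have "shift (shift (del_minus ?E \<eta>)) (jacobiator (act ?E) (br R a b) a b x)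
        = jacobiator (act ?E) (br R a b) a b (inl (del_minus M \<eta> y + scl M l w))"
      unfolding E.jacobiator_del_minus[symmetric] by (simp add: del_minus_def x scl del algebra_simps)
    also have "\<dots> = map_poly (map_poly inl) (jacobiator (act M) (br R a b) a b (del_minus M \<eta> y + scl M l w))"
      by (rule jacobiator_map[OF additive_inl additive_act E.additive_act]) (simp add: act)
    also have "\<dots> = 0" by (simp add: jacobiator_0)
    finally show ?thesis by (rule shift_eq_0[OF additive_shift[OF E.additive_del_minus]])
  qed
  then show ?thesis by (simp add: conformal_module_iff conf_mod_def conf_mod_axioms_def E.sesqui_mod_axioms)
qed

lemma map_poly_inl_inject:
  fixes p q :: "'v::ab_group_add poly"
  shows "map_poly inl p = map_poly inl q \<Longrightarrow> p = q"
  by (simp add: poly_eq_iff coeff_map_poly_additive[OF additive_inl])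

context conf_mod begin

text \<open>
  Conversely every cocycle has that form.  Since \<open>\<complex>c\<^sub>\<eta>\<close> is spanned by \<open>1\<close>, linearity determines the
  cocycle by its values at \<open>1\<close>, and sesquilinearity at \<open>(0, 1)\<close> is the divisibility condition.
\<close>

lemma cocyclesD:
  assumes z: "z \<in> cocycles R (one_dim_module \<eta>) M"
  shows "z = cochain M (\<lambda>a. fst z a 1) (snd z 1)"
    and "shift (del_minus M \<eta>) (fst z a 1) = act M a (snd z 1)"
proof -
  let ?E = "twisted_sum (one_dim_module \<eta>) M z"
  interpret E: conf_mod R ?E
    using z by (simp add: cocycles_def conformal_module_iff)
  note [simp] = twisted_sum_sel Modules.additive.zero[OF additive_act] Modules.additive.zero[OF additive_del]
  have snd: "snd z k = scl M k (snd z 1)" for k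
    using E.del_scl[of k "(0, 1)"] by simp
  have fst: "fst z a k = map_poly (scl M k) (fst z a 1)" for a k
  proof (rule map_poly_inl_inject)
    have "map_poly inl (fst z a k) = map_poly (scl ?E k) (map_poly inl (fst z a 1))"
      using E.act_scl[of a k "(0, 1)"] by simp
    also have "\<dots> = map_poly inl (map_poly (scl M k) (fst z a 1))"
      by (intro poly_eqI) (simp add: coeff_map_poly zero_prod_def)
    finally show "map_poly inl (fst z a k) = map_poly inl (map_poly (scl M k) (fst z a 1))" .
  qed
  show "z = cochain M (\<lambda>a. fst z a 1) (snd z 1)"
    unfolding cochain_def by (rule prod_eqI; intro ext) (simp_all only: fst_conv snd_conv fst[symmetric] snd[symmetric])
  have 0: "snd z 0 = 0" "fst z a 0 = 0"
    using snd[of 0] fst[of a 0] by (simp_all add: poly_eq_iff coeff_map_poly)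
  show "shift (del_minus M \<eta>) (fst z a 1) = act M a (snd z 1)"
  proof (rule map_poly_inl_inject)
    have "map_poly inl (act M a (snd z 1)) = act ?E a (del_minus ?E \<eta> (0, 1))"
      by (simp add: del_minus_def 0)
    also have "\<dots> = shift (del_minus ?E \<eta>) (map_poly inl (fst z a 1))"
      unfolding E.act_del_minus by simp
    also have "\<dots> = map_poly inl (shift (del_minus M \<eta>) (fst z a 1))"
      by (intro map_poly_shift[symmetric] additive_inl additive_del_minus E.additive_del_minus)
         (simp add: del_minus_def 0)
    finally show "map_poly inl (shift (del_minus M \<eta>) (fst z a 1)) = map_poly inl (act M a (snd z 1))" ..
  qed
qed

lemma cochain_mem_cocycles:
  "(\<And>a. shift (del_minus M \<eta>) (\<psi> a) = act M a w) \<Longrightarrow> cochain M \<psi> w \<in> cocycles R (one_dim_module \<eta>) M"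
  by (simp add: cocycles_def conformal_twisted_sum)

lemma zero_cochain_mem_cocycles: "zero_cochain \<in> cocycles R (one_dim_module \<eta>) M"
proof -
  have "cochain M (\<lambda>a. 0) 0 \<in> cocycles R (one_dim_module \<eta>) M"
    by (rule cochain_mem_cocycles) (simp add: shift_def Modules.additive.zero[OF additive_act])
  then show ?thesis by (simp add: cochain_def zero_cochain_def)
qed

end

section \<open>Classification of extensions by \<open>(\<partial> - \<eta>)c\<close>\<close>

locale one_dim_ext = V: conf_mod R V + E: conf_mod R E
  for R :: "'r::ab_group_add lca" and V :: "('r, 'v::ab_group_add) cmod" and E :: "('r, 'e::ab_group_add) cmod"
  and \<eta> i p +
  assumes ext: "extension R (one_dim_module \<eta>) V E i p"
begin

lemma i_add: "i (x + y) = i x + i y"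
  and i_scl: "i (scl V k x) = scl E k (i x)"
  and i_del: "i (del V x) = del E (i x)"
  and i_act: "map_poly i (act V a x) = act E a (i x)"
  and p_add: "p (d + e) = p d + p e"
  and p_scl: "p (scl E k e) = k * p e"
  and p_del: "p (del E e) = \<eta> * p e"
  and p_act: "map_poly p (act E a e) = 0"
  and inj_i: "inj i"
  and surj_p: "surj p"
  and range_i: "range i = {x. p x = 0}"
  using ext unfolding extension_def conf_hom_def Vector_Spaces.linear_iff
  by (auto simp: one_dim_module_def)

lemma additive_i: "Modules.additive i"
  by (simp add: Modules.additive_def i_add)

lemma additive_p: "Modules.additive p"
  by (simp add: Modules.additive_def p_add)

lemma p_i: "p (i x) = 0"
  using range_i by blast

lemma i_del_minus: "i (del_minus V \<eta> x) = del_minus E \<eta> (i x)"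
  by (simp add: del_minus_def Modules.additive.diff[OF additive_i] i_del i_scl)

lemma p_del_minus: "p (del_minus E \<eta> e) = 0"
  by (simp add: del_minus_def Modules.additive.diff[OF additive_p] p_del p_scl)

lemma lift_exists: obtains c w where "p c = 1" "del_minus E \<eta> c = i w"
proof -
  obtain c where "p c = 1" using surj_p by (metis surjD)
  moreover obtain w where "del_minus E \<eta> c = i w"
    using range_i p_del_minus[of c] by blast
  ultimately show thesis using that by blast
qed

lemma map_poly_i_shift:
  "map_poly i (shift (del_minus V \<eta>) q) = shift (del_minus E \<eta>) (map_poly i q)"
  by (intro map_poly_shift additive_i V.additive_del_minus E.additive_del_minus i_del_minus)

text \<open>
  \<open>a\<^sub>\<lambda> c\<close> has coefficients in \<open>V\<close> because \<open>a\<^sub>\<lambda>\<close> acts by zero on the quotient, and it is the quotient of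
  \<open>a\<^sub>\<lambda> w\<close> by \<open>\<partial> - \<eta> + \<lambda>\<close>.
\<close>

lemma act_lift:
  assumes c: "del_minus E \<eta> c = i w"
  obtains q where "act E a c = map_poly i q" "shift (del_minus V \<eta>) q = act V a w"
proof -
  define q where "q = map_poly (inv_into UNIV i) (act E a c)"
  have inv0: "inv_into UNIV i 0 = 0"
    using inv_f_f[OF inj_i, of 0] by (simp add: Modules.additive.zero[OF additive_i])
  have "p (coeff (act E a c) n) = 0" for n
    using arg_cong[OF p_act[of a c], of "\<lambda>q. coeff q n"] by (simp add: coeff_map_poly_additive additive_p)
  then have "coeff (act E a c) n \<in> range i" for n
    using range_i by blast
  then have q: "act E a c = map_poly i q"
    by (intro poly_eqI) (simp add: q_def coeff_map_poly_additive additive_i coeff_map_poly inv0 f_inv_into_f)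
  have "map_poly i (shift (del_minus V \<eta>) q) = map_poly i (act V a w)"
    by (simp add: map_poly_i_shift i_act flip: q c) (simp add: E.act_del_minus)
  then have "i (coeff (shift (del_minus V \<eta>) q) n) = i (coeff (act V a w) n)" for n
    by (metis additive_i coeff_map_poly_additive)
  then have "shift (del_minus V \<eta>) q = act V a w"
    using inj_i by (intro poly_eqI) (simp add: inj_eq)
  with q show thesis by (rule that)
qed

lemma decompose:
  assumes "p c = 1"
  obtains x where "e = i x + scl E (p e) c"
proof -
  have "p (e - scl E (p e) c) = 0"
    using assms by (simp add: Modules.additive.diff[OF additive_p] p_scl)
  then obtain x where "e - scl E (p e) c = i x" using range_i by blast
  then have "e = i x + scl E (p e) c" by (simp add: algebra_simps)
  then show thesis by (rule that)
qed

text \<open>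
  The isomorphism is \<open>i x + kc \<mapsto> (x, k)\<close>.  It is linear and commutes with \<open>\<partial>\<close> by comparing the two values of
  \<open>(\<partial> - \<eta>)c\<close>.  That it also commutes with every \<open>a\<^sub>\<lambda>\<close> need only be checked after applying the injective
  operator \<open>\<partial> - \<eta> + \<lambda>\<close>; then the argument of \<open>a\<^sub>\<lambda>\<close> lies in \<open>V\<close>, where the map is the identity.
\<close>

lemma equiv_twisted_sum:
  assumes pc: "p c = 1" and c: "del_minus E \<eta> c = i (snd z 1)"
    and z: "z \<in> cocycles R (one_dim_module \<eta>) V"
  shows "equiv_ext E i p (twisted_sum (one_dim_module \<eta>) V z) inl snd"
proof -
  let ?F = "twisted_sum (one_dim_module \<eta>) V z"
  interpret F: conf_mod R ?F
    using z by (simp add: cocycles_def conformal_module_iff)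
  note z' = V.cocyclesD(1)[OF z]
  have zk: "snd z k = scl V k (snd z 1)" "fst z a 0 = 0" for k a
    by (subst z', simp add: cochain_def poly_eq_iff coeff_map_poly)+
  note [simp] = twisted_sum_sel
  define \<phi> where "\<phi> e = (inv_into UNIV i (e - scl E (p e) c), p e)" for e
  have \<phi>_eq: "\<phi> (i x + scl E k c) = (x, k)" for x k
    by (simp add: \<phi>_def p_add p_i p_scl pc inj_i)
  have \<phi>_i: "\<phi> (i x) = (x, 0)" for x
    using \<phi>_eq[of x 0] by simp
  have \<phi>_add: "\<phi> (d + e) = \<phi> d + \<phi> e" for d e
  proof -
    obtain x y where "d = i x + scl E (p d) c" "e = i y + scl E (p e) c"
      using decompose[OF pc] by metis
    moreover from this have "d + e = i (x + y) + scl E (p d + p e) c"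
      by (metis (no_types, lifting) E.V.scale_left_distrib i_add add.assoc add.left_commute)
    ultimately show ?thesis using \<phi>_eq by (metis add_Pair)
  qed
  have \<phi>_scl: "\<phi> (scl E k e) = scl ?F k (\<phi> e)" for k e
  proof -
    obtain x where e: "e = i x + scl E (p e) c" using decompose[OF pc] by metis
    then have "scl E k e = i (scl V k x) + scl E (k * p e) c"
      by (metis E.V.scale_right_distrib E.V.scale_scale i_scl)
    then show ?thesis using \<phi>_eq e by (metis twisted_sum_sel(1))
  qed
  have \<phi>_T: "\<phi> (del_minus E \<eta> e) = del_minus ?F \<eta> (\<phi> e)" for e
  proof -
    obtain x where e: "e = i x + scl E (p e) c" using decompose[OF pc] by metis
    have "del_minus E \<eta> e = i (del_minus V \<eta> x + snd z (p e))"
      by (subst e) (simp add: Modules.additive.add[OF E.additive_del_minus] E.del_minus_scl c i_add i_scl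
         i_del_minus zk(1)[of "p e"])
    then have "\<phi> (del_minus E \<eta> e) = (del_minus V \<eta> x + snd z (p e), 0)"
      by (simp add: \<phi>_i)
    also have "\<dots> = del_minus ?F \<eta> (x, p e)"
      by (simp add: del_minus_def)
    finally show ?thesis using \<phi>_eq e by metis
  qed
  have additive_\<phi>: "Modules.additive \<phi>"
    by (simp add: Modules.additive_def \<phi>_add)
  have \<phi>_del: "\<phi> (del E e) = del ?F (\<phi> e)" for e
    using \<phi>_T[of e] by (simp add: del_minus_def Modules.additive.diff[OF additive_\<phi>] \<phi>_scl)
  have \<phi>_act: "map_poly \<phi> (act E a e) = act ?F a (\<phi> e)" for a e
  proof (rule F.shift_eqD[of \<eta>])
    obtain y where y: "del_minus E \<eta> e = i y"
      using range_i p_del_minus[of e] by blast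
    have "shift (del_minus ?F \<eta>) (map_poly \<phi> (act E a e)) = map_poly \<phi> (act E a (del_minus E \<eta> e))"
      by (simp add: E.act_del_minus map_poly_shift[OF additive_\<phi> E.additive_del_minus F.additive_del_minus \<phi>_T])
    also have "\<dots> = map_poly inl (act V a y)"
      by (simp add: y i_act[symmetric] map_poly_comp_additive additive_\<phi> additive_i \<phi>_i)
    also have "\<dots> = act ?F a (\<phi> (del_minus E \<eta> e))"
      by (simp add: y \<phi>_i zk(2))
    also have "\<dots> = shift (del_minus ?F \<eta>) (act ?F a (\<phi> e))"
      by (simp add: \<phi>_T F.act_del_minus)
    finally show "shift (del_minus ?F \<eta>) (map_poly \<phi> (act E a e)) = shift (del_minus ?F \<eta>) (act ?F a (\<phi> e))" .
  qed
  have "conf_hom E ?F \<phi>"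
    unfolding conf_hom_def Vector_Spaces.linear_iff
    using E.vs F.vs \<phi>_add \<phi>_scl \<phi>_del \<phi>_act by blast
  moreover have "snd (\<phi> e) = p e" for e by (simp add: \<phi>_def)
  ultimately show ?thesis unfolding equiv_ext_def using \<phi>_i by blast
qed

text \<open>
  If \<open>w = (\<partial> - \<eta>)u\<close> then the lift \<open>c - u\<close> is annihilated by \<open>\<partial> - \<eta>\<close>, as is the lift \<open>(0, 1)\<close> in the direct
  sum.  Conversely, a homomorphism to the direct sum sends \<open>c\<close> to some \<open>(u, 1)\<close>, and applying \<open>\<partial> - \<eta>\<close> gives
  \<open>w = (\<partial> - \<eta>)u\<close>.
\<close>

lemma trivial_ext_iff:
  assumes pc: "p c = 1" and c: "del_minus E \<eta> c = i w"
  shows "trivial_ext (one_dim_module \<eta>) V E i p \<longleftrightarrow> (\<exists>u. w = del_minus V \<eta> u)"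
proof
  let ?D = "direct_sum (one_dim_module \<eta>) V"
  assume "trivial_ext (one_dim_module \<eta>) V E i p"
  then obtain \<phi> where "conf_hom E ?D \<phi>" and \<phi>_i: "\<And>x. \<phi> (i x) = (x, 0)" and \<phi>_p: "\<And>e. snd (\<phi> e) = p e"
    unfolding trivial_ext_def equiv_ext_def by auto
  then have \<phi>: "Modules.additive \<phi>" "\<And>k e. \<phi> (scl E k e) = scl ?D k (\<phi> e)" "\<And>e. \<phi> (del E e) = del ?D (\<phi> e)"
    unfolding conf_hom_def Vector_Spaces.linear_iff by (auto simp: Modules.additive_def)
  obtain u where u: "\<phi> c = (u, 1)" using \<phi>_p[of c] pc by (metis prod.collapse)
  have "(w, 0) = \<phi> (del_minus E \<eta> c)" by (simp add: c \<phi>_i)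
  also have "\<dots> = (del_minus V \<eta> u, 0)"
    by (simp add: del_minus_def Modules.additive.diff[OF \<phi>(1)] \<phi>(2,3) u direct_sum_def twisted_sum_sel zero_cochain_def)
  finally show "\<exists>u. w = del_minus V \<eta> u" by blast
next
  assume "\<exists>u. w = del_minus V \<eta> u"
  then obtain u where u: "w = del_minus V \<eta> u" by blast
  have "p (c - i u) = 1" by (simp add: Modules.additive.diff[OF additive_p] pc p_i)
  moreover have "del_minus E \<eta> (c - i u) = i (snd zero_cochain 1)"
    by (simp add: Modules.additive.diff[OF E.additive_del_minus] c u i_del_minus zero_cochain_def
        Modules.additive.zero[OF additive_i])
  ultimately show "trivial_ext (one_dim_module \<eta>) V E i p"
    unfolding trivial_ext_def direct_sum_def
    using V.zero_cochain_mem_cocycles by (rule equiv_twisted_sum)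
qed

end

lemma (in conf_mod) one_dim_extI:
  assumes "extension R (one_dim_module \<eta>) M E i p"
  shows "one_dim_ext R M E \<eta> i p"
proof -
  have "conf_mod R E"
    using assms unfolding extension_def conformal_module_iff by blast
  with assms conf_mod_axioms show ?thesis
    by (intro one_dim_ext.intro one_dim_ext_axioms.intro)
qed

lemma (in conf_mod) extension_twisted_sum:
  assumes z: "z \<in> cocycles R (one_dim_module \<eta>) M"
  shows "extension R (one_dim_module \<eta>) M (twisted_sum (one_dim_module \<eta>) M z) inl snd"
proof -
  let ?E = "twisted_sum (one_dim_module \<eta>) M z"
  interpret E: conf_mod R ?E
    using z by (simp add: cocycles_def conformal_module_iff)
  have z0: "snd z 0 = 0" "fst z a 0 = 0" for a
    by (subst cocyclesD(1)[OF z], simp add: cochain_def poly_eq_iff coeff_map_poly)+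
  have "vector_space ((*) :: complex \<Rightarrow> complex \<Rightarrow> complex)"
    by unfold_locales (simp_all add: algebra_simps)
  moreover have "map_poly snd (act ?E a x) = 0" for a x
    by (cases x) (simp add: twisted_sum_sel poly_eq_iff coeff_map_poly
        coeff_map_poly_additive[OF additive_inl])
  ultimately have "conf_hom ?E (one_dim_module \<eta>) snd"
    unfolding conf_hom_def Vector_Spaces.linear_iff using E.vs
    by (auto simp: one_dim_module_def twisted_sum_def)
  moreover have "conf_hom M ?E inl"
    unfolding conf_hom_def Vector_Spaces.linear_iff using vs E.vs
    by (simp add: twisted_sum_sel z0)
  moreover have "range inl = {x :: 'b \<times> complex. snd x = 0}" by force
  ultimately show ?thesis
    unfolding extension_def using E.conf_mod_axioms
    by (simp add: conformal_module_iff inj_def surj_def)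
qed

section \<open>Modules that are free of rank one over \<open>\<complex>[\<partial>]\<close>\<close>

context conf_mod begin

lemma pact_eq_sum:
  assumes "degree p \<le> N"
  shows "pact M p x = (\<Sum>i\<le>N. scl M (coeff p i) ((del M ^^ i) x))"
  unfolding pact_def using assms
  by (intro sum.mono_neutral_left) (auto simp: coeff_eq_0)

lemma pact_pCons: "pact M (pCons k p) x = scl M k x + del M (pact M p x)"
  by (simp add: pact_eq_sum[of "pCons k p" "Suc (degree p)"] degree_pCons_le
      pact_eq_sum[of p "degree p"] sum.atMost_Suc_shift Modules.additive.sum[OF additive_del] del_scl
      del: sum.atMost_Suc)

lemma pact_0: "pact M 0 x = 0"
  by (simp add: pact_def)

lemma pact_add: "pact M (p + q) x = pact M p x + pact M q x"
proof -
  define N where "N = max (degree p) (degree q)"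
  have "degree p \<le> N" "degree q \<le> N" "degree (p + q) \<le> N"
    by (auto simp: N_def degree_add_le)
  then show ?thesis
    by (simp add: pact_eq_sum[of _ N] V.scale_left_distrib sum.distrib)
qed

lemma pact_smult: "pact M (Polynomial.smult k p) x = scl M k (pact M p x)"
  by (simp add: pact_eq_sum[of "Polynomial.smult k p" "degree p"] degree_smult_le
      pact_eq_sum[of p "degree p"] V.scale_sum_right)

lemma pact_const: "pact M [:k:] x = scl M k x"
  by (simp add: pact_pCons pact_0 Modules.additive.zero[OF additive_del])

lemma pact_root_factor: "pact M ([:-\<eta>, 1:] * p) x = del_minus M \<eta> (pact M p x)"
proof -
  have "[:-\<eta>, 1:] * p = pCons 0 p + Polynomial.smult (-\<eta>) p" by simp
  then show ?thesis
    by (simp only: pact_add pact_smult pact_pCons) (simp add: del_minus_def V.scale_minus_left)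
qed

lemma pact_map:
  assumes "Modules.additive i" "\<And>k y. i (scl M k y) = scl E k (i y)" "\<And>y. i (del M y) = del E (i y)"
  shows "pact E p (i x) = i (pact M p x)"
proof -
  have "(del E ^^ n) (i x) = i ((del M ^^ n) x)" for n
    by (induction n) (simp_all add: assms(3))
  then show ?thesis
    by (simp add: pact_def Modules.additive.sum[OF assms(1)] assms(2))
qed

end

text \<open>
  The properties of \<open>V\<^sub>\<alpha>\<^sub>,\<^sub>\<beta>\<close> and of the algebra on which the classification rests: \<open>A\<close> and \<open>B\<close> generate the
  algebra over \<open>\<complex>[\<partial>]\<close>, and their action on the free generator \<open>v\<close> is given.
\<close>

locale rank_one = V: conf_mod R V
  for R :: "'r::ab_group_add lca" and V :: "('r, 'v::ab_group_add) cmod" +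
  fixes A B :: 'r and \<alpha> \<beta> :: complex and v :: 'v
  assumes generated: "\<exists>x y. a = pact R x A + pact R y B"
    and bij: "bij (\<lambda>x. pact V x v)"
    and act_A: "act V A v = pact2 V (dvar + cnst \<alpha> * lvar + cnst \<beta>) v"
    and act_B: "act V B v = 0"
begin

definition coord :: "'v \<Rightarrow> complex poly" where
  "coord = inv_into UNIV (\<lambda>x. pact V x v)"

lemma pact_coord: "pact V (coord y) v = y"
  using bij unfolding coord_def by (metis bij_inv_eq_iff)

lemma coord_pact: "coord (pact V x v) = x"
  using bij unfolding coord_def by (metis bij_inv_eq_iff)

lemma coord_eqI: "pact V x v = y \<Longrightarrow> coord y = x"
  using coord_pact by blast

text \<open>
  The functional \<open>h(\<partial>)v \<mapsto> h(\<eta>)\<close>, which identifies \<open>V/(\<partial> - \<eta>)V\<close> with \<open>\<complex>\<close>.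
\<close>

definition ev :: "complex \<Rightarrow> 'v \<Rightarrow> complex" where
  "ev \<eta> y = poly (coord y) \<eta>"

lemma ev_add: "ev \<eta> (x + y) = ev \<eta> x + ev \<eta> y"
proof -
  have "coord (x + y) = coord x + coord y"
    by (rule coord_eqI) (simp add: V.pact_add pact_coord)
  then show ?thesis by (simp add: ev_def)
qed

lemma ev_scl: "ev \<eta> (scl V k x) = k * ev \<eta> x"
proof -
  have "coord (scl V k x) = Polynomial.smult k (coord x)"
    by (rule coord_eqI) (simp add: V.pact_smult pact_coord)
  then show ?thesis by (simp add: ev_def)
qed

lemma ev_generator: "ev \<eta> (scl V s v) = s"
  by (simp add: ev_def V.pact_const coord_pact flip: V.pact_const)

lemma ev_eq_0_iff: "ev \<eta> y = 0 \<longleftrightarrow> (\<exists>u. y = del_minus V \<eta> u)"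
proof
  assume "ev \<eta> y = 0"
  then obtain q where "coord y = [:-\<eta>, 1:] * q"
    unfolding ev_def poly_eq_0_iff_dvd by (elim dvdE)
  then have "y = del_minus V \<eta> (pact V q v)"
    by (metis V.pact_root_factor pact_coord)
  then show "\<exists>u. y = del_minus V \<eta> u" ..
next
  assume "\<exists>u. y = del_minus V \<eta> u"
  then obtain u where "y = del_minus V \<eta> u" ..
  then have "coord y = [:-\<eta>, 1:] * coord u"
    by (intro coord_eqI) (simp only: V.pact_root_factor pact_coord)
  then show "ev \<eta> y = 0" by (simp add: ev_def)
qed

lemma act_A_eq: "act V A v = [:del V v + scl V \<beta> v, scl V \<alpha> v:]"
proof -
  have "dvar + cnst \<alpha> * lvar + cnst \<beta> = [:[:\<beta>, 1:], [:\<alpha>:]:]"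
    by (simp add: dvar_def cnst_def lvar_def)
  then show ?thesis
    unfolding act_A pact2_def
    by (simp add: map_poly_pCons V.pact_0 V.pact_pCons Modules.additive.zero[OF V.additive_del])
qed

text \<open>
  \<open>A\<^sub>\<lambda> v = (\<partial> + \<beta>)v + \<lambda>\<alpha>v\<close> has degree at most one in \<open>\<lambda>\<close>, so its quotient by \<open>\<partial> - \<eta> + \<lambda>\<close> is constant in \<open>\<lambda>\<close>
  and must be \<open>\<alpha>v\<close>.  Then \<open>\<alpha>(\<partial> - \<eta>)v = (\<partial> + \<beta>)v\<close>, and freeness of \<open>V\<close> compares the coefficients.
\<close>

lemma generator_obstruction:
  assumes "s \<noteq> 0" and q: "shift (del_minus V \<eta>) q = act V A (scl V s v)"
  shows "\<alpha> = 1" and "\<beta> + \<eta> = 0"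
proof -
  define r where "r = map_poly (scl V (1 / s)) q"
  have r: "shift (del_minus V \<eta>) r = act V A v"
    unfolding r_def V.shift_scl q V.act_scl[symmetric] using assms(1) by simp
  have coeff: "coeff (act V A v) n = del_minus V \<eta> (coeff r n) + (case n of 0 \<Rightarrow> 0 | Suc m \<Rightarrow> coeff r m)" for n
    unfolding r[symmetric] by (rule coeff_shift[OF V.additive_del_minus])
  have "degree r = 0"
  proof (rule ccontr)
    assume "degree r \<noteq> 0"
    then have "coeff (act V A v) (Suc (degree r)) = 0"
      by (simp add: act_A_eq coeff_pCons split: nat.split)
    then have "lead_coeff r = 0"
      unfolding coeff by (simp add: coeff_eq_0 Modules.additive.zero[OF V.additive_del_minus])
    then show False using \<open>degree r \<noteq> 0\<close> by simp
  qed
  then have "coeff r 0 = scl V \<alpha> v"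
    using coeff[of "Suc 0"] by (simp add: act_A_eq coeff_eq_0 Modules.additive.zero[OF V.additive_del_minus])
  then have "del V v + scl V \<beta> v = del_minus V \<eta> (scl V \<alpha> v)"
    using coeff[of 0] by (simp add: act_A_eq)
  then have "pact V [:\<beta>, 1:] v = pact V ([:-\<eta>, 1:] * [:\<alpha>:]) v"
    unfolding V.pact_root_factor by (simp add: V.pact_pCons V.pact_0 Modules.additive.zero[OF V.additive_del] add.commute)
  then have "[:\<beta>, 1:] = [:-\<eta>, 1:] * [:\<alpha>:]"
    by (metis coord_pact)
  then show "\<alpha> = 1" "\<beta> + \<eta> = 0" by simp_all
qed

text \<open>
  Under these conditions \<open>A\<^sub>\<lambda> v = (\<partial> - \<eta> + \<lambda>)v\<close>.  The elements \<open>a\<close> for which \<open>a\<^sub>\<lambda> v\<close> is divisible form a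
  \<open>\<complex>[\<partial>]\<close>-submodule of the algebra, because \<open>\<partial>a\<close> acts as \<open>-\<lambda>a\<^sub>\<lambda>\<close>; it contains \<open>A\<close> and \<open>B\<close>.
\<close>

lemma divisible:
  assumes "\<alpha> = 1" and "\<beta> + \<eta> = 0"
  shows "shift (del_minus V \<eta>) [:v:] = act V A v"
    and "\<exists>q. shift (del_minus V \<eta>) q = act V a v"
proof -
  note zero = Modules.additive.zero[OF V.additive_del_minus]
  note S = additive_shift[OF V.additive_del_minus, of \<eta>]
  have "\<beta> = -\<eta>" using assms(2) by (simp add: eq_neg_iff_add_eq_0)
  then show A: "shift (del_minus V \<eta>) [:v:] = act V A v"
    by (simp add: act_A_eq shift_def map_poly_pCons zero assms(1))
       (simp add: del_minus_def)
  define D where "D = {a. \<exists>q. shift (del_minus V \<eta>) q = act V a v}"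
  have D_add: "a + b \<in> D" if "a \<in> D" "b \<in> D" for a b
    using that unfolding D_def by (auto simp: V.act_add_left) (metis Modules.additive.add[OF S])
  have D_scl: "scl R k a \<in> D" if "a \<in> D" for k a
    using that unfolding D_def by (auto simp: V.act_scl_left) (metis V.shift_scl)
  have D_del: "del R a \<in> D" if "a \<in> D" for a
  proof -
    from that obtain q where q: "shift (del_minus V \<eta>) q = act V a v" by (auto simp: D_def)
    have "shift (del_minus V \<eta>) (pCons 0 q) = pCons 0 (act V a v)"
      unfolding q[symmetric] by (simp add: shift_def map_poly_pCons zero)
    then have "shift (del_minus V \<eta>) (- pCons 0 q) = act V (del R a) v"
      by (simp only: V.act_del_left Modules.additive.minus[OF S])
    then show ?thesis by (auto simp: D_def)
  qed
  have D_pact: "pact R x a \<in> D" if "a \<in> D" for x a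
  proof -
    have mem: "scl R (coeff x n) ((del R ^^ n) a) \<in> D" for n
      by (intro D_scl, induction n) (simp_all add: that D_del)
    have "(\<Sum>i\<le>n. scl R (coeff x i) ((del R ^^ i) a)) \<in> D" for n
    proof (induction n)
      case 0
      then show ?case using mem[of 0] by simp
    next
      case (Suc n)
      then show ?case using mem[of "Suc n"] by (simp add: D_add)
    qed
    then show ?thesis by (simp add: pact_def)
  qed
  have "B \<in> D" by (auto simp: D_def act_B intro: exI[of _ 0] Modules.additive.zero[OF S])
  moreover have "A \<in> D" using A by (auto simp: D_def)
  ultimately have "a \<in> D" using generated[of a] D_add D_pact by metis
  then show "\<exists>q. shift (del_minus V \<eta>) q = act V a v" by (simp add: D_def)
qed

end

section \<open>One-dimensional quotients and the space of cocycles\<close>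

text \<open>
  A bijection with \<open>\<complex>\<close> that respects the operations makes a structure a line.  The vector space axioms are transported as
  well, so that they need not be established for the quotient beforehand.
\<close>

lemma has_dim_1I:
  fixes X :: "(complex, 'c) module"
  assumes carrier: "carrier X = range q" and "inj q"
    and add: "\<And>s t. q s \<oplus>\<^bsub>X\<^esub> q t = q (s + t)" and zero: "\<zero>\<^bsub>X\<^esub> = q 0"
    and smult: "\<And>k s. k \<odot>\<^bsub>X\<^esub> q s = q (k * s)"
  shows "has_dim X 1"
proof -
  have "abelian_group X"
  proof (rule abelian_groupI)
    fix x assume "x \<in> carrier X"
    then obtain s where "x = q s" by (auto simp: carrier)
    then show "\<exists>y\<in>carrier X. y \<oplus>\<^bsub>X\<^esub> x = \<zero>\<^bsub>X\<^esub>"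
      by (intro bexI[of _ "q (- s)"]) (auto simp: carrier add zero)
  qed (auto simp: carrier add zero algebra_simps)
  then have "Module.module class_ring X"
    by (intro moduleI class_cring.cring_axioms) (auto simp: carrier add smult algebra_simps)
  then interpret vectorspace class_ring X
    by (intro vectorspace.intro class_field.field_axioms)
  have "gen_set {q 1}"
  proof
    have sub: "{q 1} \<subseteq> carrier X" by (auto simp: carrier)
    interpret S: submodule class_ring "span {q 1}" X by (rule span_is_submodule[OF sub])
    show "span {q 1} \<subseteq> carrier X" by (rule S.subset)
    show "carrier X \<subseteq> span {q 1}"
    proof
      fix x assume "x \<in> carrier X"
      then obtain s where "x = s \<odot>\<^bsub>X\<^esub> q 1" by (auto simp: carrier smult)
      then show "x \<in> span {q 1}" using in_own_span[OF sub] by (auto intro: S.smult_closed)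
    qed
  qed
  moreover have "q 1 \<in> carrier X" by (simp add: carrier)
  moreover have "q 1 \<noteq> \<zero>\<^bsub>X\<^esub>" using \<open>inj q\<close> by (simp add: zero inj_eq)
  ultimately have "dim = 1" and "fin_dim"
    using dim1I[of "q 1"] unfolding fin_dim_def by blast+
  then show ?thesis using vectorspace_axioms by (simp add: has_dim_def)
qed

lemma cocycle_space_add:
  "z \<oplus>\<^bsub>cocycle_space R W V\<^esub> z' = (\<lambda>a w. fst z a w + fst z' a w, \<lambda>w. snd z w + snd z' w)"
  by (simp add: cocycle_space_def case_prod_beta)

lemma cocycle_space_smult:
  "k \<odot>\<^bsub>cocycle_space R W V\<^esub> z = (\<lambda>a w. map_poly (scl V k) (fst z a w), \<lambda>w. scl V k (snd z w))"
  by (simp add: cocycle_space_def case_prod_beta)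

context conf_mod begin

lemma cocycles_add:
  assumes z: "z \<in> cocycles R (one_dim_module \<eta>) M" and z': "z' \<in> cocycles R (one_dim_module \<eta>) M"
  shows "z \<oplus>\<^bsub>cocycle_space R (one_dim_module \<eta>) M\<^esub> z' \<in> cocycles R (one_dim_module \<eta>) M"
proof -
  have "cochain M \<psi> w \<oplus>\<^bsub>cocycle_space R (one_dim_module \<eta>) M\<^esub> cochain M \<psi>' w'
      = cochain M (\<lambda>a. \<psi> a + \<psi>' a) (w + w')" for \<psi> \<psi>' w w'
    by (simp add: cocycle_space_add cochain_def V.scale_right_distrib
        Modules.additive.add[OF additive_map_poly[OF additive_scl]])
  then show ?thesis
    by (subst cocyclesD(1)[OF z], subst cocyclesD(1)[OF z'])
       (auto intro!: cochain_mem_cocycles simp: act_add cocyclesD(2)[OF z] cocyclesD(2)[OF z']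
        Modules.additive.add[OF additive_shift[OF additive_del_minus]])
qed

lemma cocycles_smult:
  assumes z: "z \<in> cocycles R (one_dim_module \<eta>) M"
  shows "k \<odot>\<^bsub>cocycle_space R (one_dim_module \<eta>) M\<^esub> z \<in> cocycles R (one_dim_module \<eta>) M"
proof -
  have "k \<odot>\<^bsub>cocycle_space R (one_dim_module \<eta>) M\<^esub> cochain M \<psi> w
      = cochain M (\<lambda>a. map_poly (scl M k) (\<psi> a)) (scl M k w)" for \<psi> w
    by (simp add: cocycle_space_smult cochain_def map_poly_comp_additive additive_scl mult.commute)
  then show ?thesis
    by (subst cocyclesD(1)[OF z])
       (auto intro!: cochain_mem_cocycles simp: act_scl shift_scl cocyclesD(2)[OF z])
qed

lemma cocycle_diff_add:
  "(z \<oplus>\<^bsub>cocycle_space R W M\<^esub> ((-1) \<odot>\<^bsub>cocycle_space R W M\<^esub> y)) \<oplus>\<^bsub>cocycle_space R W M\<^esub> y = z"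
  by (simp add: cocycle_space_add cocycle_space_smult prod_eq_iff fun_eq_iff poly_eq_iff
      coeff_map_poly V.scale_minus_left)

text \<open>
  The lift \<open>(0, 1)\<close> in a twisted sum satisfies \<open>(\<partial> - \<eta>)(0, 1) = (w, 0)\<close> with \<open>w\<close> the value at \<open>1\<close> of the second
  component of the cocycle.
\<close>

lemma trivial_cocycles_eq:
  "trivial_cocycles R (one_dim_module \<eta>) M
    = {z \<in> cocycles R (one_dim_module \<eta>) M. \<exists>u. snd z 1 = del_minus M \<eta> u}"
proof -
  have "trivial_ext (one_dim_module \<eta>) M (twisted_sum (one_dim_module \<eta>) M z) inl snd
      \<longleftrightarrow> (\<exists>u. snd z 1 = del_minus M \<eta> u)"
    if z: "z \<in> cocycles R (one_dim_module \<eta>) M" for z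
  proof -
    interpret one_dim_ext R M "twisted_sum (one_dim_module \<eta>) M z" \<eta> inl snd
      by (rule one_dim_extI[OF extension_twisted_sum[OF z]])
    show ?thesis
      by (rule trivial_ext_iff[of "(0, 1)"])
         (simp_all add: del_minus_def twisted_sum_sel Modules.additive.zero[OF additive_del])
  qed
  then show ?thesis unfolding trivial_cocycles_def by blast
qed

end

section \<open>Extensions of \<open>\<complex>c\<^sub>\<eta>\<close> by a module of rank one\<close>

context rank_one begin

text \<open>
  Changing the lift \<open>c\<close> by \<open>u \<in> V\<close> changes \<open>(\<partial> - \<eta>)c\<close> by \<open>(\<partial> - \<eta>)u\<close>, and modulo \<open>(\<partial> - \<eta>)V\<close> every element of
  \<open>V\<close> is a multiple of \<open>v\<close>.
\<close>

lemma normal_lift: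
  assumes "extension R (one_dim_module \<eta>) V E i p"
  obtains c s where "p c = 1" "del_minus E \<eta> c = i (scl V s v)"
proof -
  interpret X: one_dim_ext R V E \<eta> i p by (rule V.one_dim_extI[OF assms])
  obtain c w where c: "p c = 1" "del_minus E \<eta> c = i w" by (rule X.lift_exists)
  define s where "s = ev \<eta> w"
  have "ev \<eta> (w + scl V (- s) v) = 0"
    unfolding ev_add ev_generator by (simp add: s_def)
  then obtain u where "w + scl V (- s) v = del_minus V \<eta> u" by (auto simp: ev_eq_0_iff)
  then have w: "w = del_minus V \<eta> u + scl V s v"
    by (simp add: V.V.scale_minus_left algebra_simps)
  have "p (c - i u) = 1"
    by (simp add: Modules.additive.diff[OF X.additive_p] c X.p_i)
  moreover have "del_minus E \<eta> (c - i u) = i (scl V s v)"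
    by (simp add: Modules.additive.diff[OF X.E.additive_del_minus] c w X.i_add X.i_del_minus)
  ultimately show thesis by (rule that)
qed

lemma trivial_ext_iff_0:
  assumes "extension R (one_dim_module \<eta>) V E i p" "p c = 1" "del_minus E \<eta> c = i (scl V s v)"
  shows "trivial_ext (one_dim_module \<eta>) V E i p \<longleftrightarrow> s = 0"
  using one_dim_ext.trivial_ext_iff[OF V.one_dim_extI[OF assms(1)] assms(2,3)]
  by (simp add: ev_generator flip: ev_eq_0_iff)

lemma parameters_of_nontrivial:
  assumes ext: "extension R (one_dim_module \<eta>) V E i p"
    and c: "del_minus E \<eta> c = i (scl V s v)" and "s \<noteq> 0"
  shows "\<alpha> = 1" and "\<beta> + \<eta> = 0"
proof -
  interpret X: one_dim_ext R V E \<eta> i p by (rule V.one_dim_extI[OF ext])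
  obtain q where "shift (del_minus V \<eta>) q = act V A (scl V s v)"
    using X.act_lift[OF c] by metis
  then show "\<alpha> = 1" and "\<beta> + \<eta> = 0"
    using generator_obstruction[OF \<open>s \<noteq> 0\<close>] by blast+
qed

text \<open>
  The first four clauses of \<open>ext_shape\<close> hold for every lift of \<open>c\<^sub>\<eta>\<close>; only \<open>f\<close>, \<open>g\<close>, \<open>h\<close> depend on the extension.
\<close>

lemma ext_shapeI:
  assumes ext: "extension R (one_dim_module \<eta>) V E i p" and pc: "p c = 1"
    and c: "del_minus E \<eta> c = i (pact V h v)"
    and f: "act E A c = pact2 E f (i v)" and g: "act E B c = pact2 E g (i v)"
  shows "ext_shape A B \<alpha> \<beta> \<eta> v E i p c f g h"
proof -
  interpret X: one_dim_ext R V E \<eta> i p by (rule V.one_dim_extI[OF ext])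
  have pact: "pact E x (i v) = i (pact V x v)" for x
    by (rule V.pact_map[OF X.additive_i X.i_scl X.i_del])
  have "bij (\<lambda>(x, k). pact E x (i v) + scl E k c)"
  proof (rule bijI)
    show "inj (\<lambda>(x, k). pact E x (i v) + scl E k c)"
    proof (rule injI, clarify)
      fix x k x' k'
      assume eq: "pact E x (i v) + scl E k c = pact E x' (i v) + scl E k' c"
      from arg_cong[OF eq, of p] have "k = k'" by (simp add: X.p_add X.p_scl pact X.p_i pc)
      moreover from this eq have "pact V x v = pact V x' v" by (simp add: pact inj_eq[OF X.inj_i])
      ultimately show "x = x' \<and> k = k'" by (metis coord_pact)
    qed
    have "\<exists>xk. e = (\<lambda>(x, k). pact E x (i v) + scl E k c) xk" for e
    proof -
      obtain y where y: "e = i y + scl E (p e) c" using X.decompose[OF pc] by metis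
      show ?thesis
        by (rule exI[of _ "(coord y, p e)"], unfold case_prod_conv pact pact_coord) (rule y)
    qed
    then show "surj (\<lambda>(x, k). pact E x (i v) + scl E k c)" unfolding surj_def by blast
  qed
  moreover have "act E A (i v) = pact2 E (dvar + cnst \<alpha> * lvar + cnst \<beta>) (i v)"
    unfolding X.i_act[symmetric] act_A pact2_def
    by (intro poly_eqI)
       (simp add: coeff_map_poly_additive X.additive_i coeff_map_poly V.pact_0 pact
          Modules.additive.zero[OF X.additive_i])
  moreover have "act E B (i v) = 0"
    by (simp add: X.i_act[symmetric] act_B)
  moreover have "del E c = scl E \<eta> c + pact E h (i v)"
    using c by (simp add: del_minus_def pact algebra_simps)
  ultimately show ?thesis
    unfolding ext_shape_def using pc f g by blast
qed

lemma ext_shape_exists: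
  assumes ext: "extension R (one_dim_module \<eta>) V E i p"
  shows "\<exists>c f g h. ext_shape A B \<alpha> \<beta> \<eta> v E i p c f g h"
proof -
  interpret X: one_dim_ext R V E \<eta> i p by (rule V.one_dim_extI[OF ext])
  obtain c w where c: "p c = 1" "del_minus E \<eta> c = i w" by (rule X.lift_exists)
  have "\<exists>f. act E a c = pact2 E f (i v)" for a
  proof -
    obtain q where q: "act E a c = map_poly i q" using X.act_lift[OF c(2)] by metis
    have "coord 0 = 0" by (rule coord_eqI) (rule V.pact_0)
    then have "act E a c = pact2 E (map_poly coord q) (i v)"
      unfolding q pact2_def
      by (intro poly_eqI) (simp add: coeff_map_poly_additive X.additive_i coeff_map_poly V.pact_0
          Modules.additive.zero[OF X.additive_i] V.pact_map[OF X.additive_i X.i_scl X.i_del] pact_coord)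
    then show ?thesis ..
  qed
  then obtain f g where "act E A c = pact2 E f (i v)" "act E B c = pact2 E g (i v)" by metis
  moreover have "del_minus E \<eta> c = i (pact V (coord w) v)" by (simp add: c pact_coord)
  ultimately show ?thesis using ext_shapeI[OF ext c(1)] by blast
qed

context
  fixes \<eta> assumes \<alpha>: "\<alpha> = 1" and \<beta>: "\<beta> + \<eta> = 0"
begin

text \<open>
  Dividing \<open>A\<^sub>\<lambda>(sv) = s(\<partial> - \<eta> + \<lambda>)v\<close> and \<open>B\<^sub>\<lambda>(sv) = 0\<close> gives \<open>A\<^sub>\<lambda> c = sv\<close> and \<open>B\<^sub>\<lambda> c = 0\<close>, while \<open>(\<partial> - \<eta>)c = sv\<close>: this is
  where \<open>f = h = s\<close> and \<open>g = 0\<close> come from.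
\<close>

lemma constant_cocycle:
  obtains z where "z \<in> cocycles R (one_dim_module \<eta>) V" "snd z 1 = scl V s v"
    "ext_shape A B \<alpha> \<beta> \<eta> v (twisted_sum (one_dim_module \<eta>) V z) inl snd (0, 1) (cnst s) 0 [:s:]"
proof -
  obtain \<psi> where \<psi>: "\<And>a. shift (del_minus V \<eta>) (\<psi> a) = act V a v"
    using divisible(2)[OF \<alpha> \<beta>] by metis
  have \<psi>A: "\<psi> A = [:v:]"
    by (rule V.shift_eqD[of \<eta>]) (simp add: \<psi> divisible(1)[OF \<alpha> \<beta>])
  have \<psi>B: "\<psi> B = 0"
    by (rule V.shift_eqD[of \<eta>])
       (simp add: \<psi> act_B Modules.additive.zero[OF additive_shift[OF V.additive_del_minus]])
  define z where "z = cochain V (\<lambda>a. map_poly (scl V s) (\<psi> a)) (scl V s v)"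
  let ?E = "twisted_sum (one_dim_module \<eta>) V z"
  have z: "z \<in> cocycles R (one_dim_module \<eta>) V"
    unfolding z_def by (rule V.cochain_mem_cocycles) (simp add: V.shift_scl \<psi> V.act_scl)
  interpret X: one_dim_ext R V ?E \<eta> inl snd
    by (rule V.one_dim_extI[OF V.extension_twisted_sum[OF z]])
  have w: "snd z 1 = scl V s v" by (simp add: z_def cochain_def)
  have "ext_shape A B \<alpha> \<beta> \<eta> v ?E inl snd (0, 1) (cnst s) 0 [:s:]"
  proof (rule ext_shapeI[OF X.ext])
    show "del_minus ?E \<eta> (0, 1) = inl (pact V [:s:] v)"
      by (simp add: del_minus_def twisted_sum_sel w V.pact_const Modules.additive.zero[OF V.additive_del])
    show "act ?E A (0, 1) = pact2 ?E (cnst s) (inl v)"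
    proof -
      have "pact2 ?E (cnst s) (inl v) = [:inl (scl V s v):]"
        by (simp add: pact2_def cnst_def map_poly_pCons X.E.pact_0 X.E.pact_const twisted_sum_sel)
      moreover have "act ?E A (0, 1) = map_poly inl [:scl V s v:]"
        by (simp add: twisted_sum_sel z_def cochain_def \<psi>A map_poly_pCons
            Modules.additive.zero[OF V.additive_act])
      ultimately show ?thesis
        by (simp only: map_poly_pCons Modules.additive.zero[OF additive_inl] map_poly_0)
    qed
    show "act ?E B (0, 1) = pact2 ?E 0 (inl v)"
      by (simp add: twisted_sum_sel z_def cochain_def \<psi>B pact2_def Modules.additive.zero[OF V.additive_act])
  qed simp
  with z w show thesis by (rule that)
qed

text \<open>
  The functional \<open>z \<mapsto> ev (z(1))\<close> on cocycles has the trivial cocycles as kernel and takes every value on the constant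
  cocycles.  Its level sets are therefore the cosets, indexed by \<open>\<complex>\<close>.
\<close>

lemma has_dim_Ext: "has_dim (Ext R (one_dim_module \<eta>) V) 1"
proof -
  let ?C = "cocycles R (one_dim_module \<eta>) V" and ?Z = "cocycle_space R (one_dim_module \<eta>) V"
  let ?T = "trivial_cocycles R (one_dim_module \<eta>) V"
  define level where "level s = {z \<in> ?C. ev \<eta> (snd z 1) = s}" for s
  have T: "?T = level 0"
    unfolding V.trivial_cocycles_eq level_def ev_eq_0_iff ..
  have ev_plus: "ev \<eta> (snd (z \<oplus>\<^bsub>?Z\<^esub> z') 1) = ev \<eta> (snd z 1) + ev \<eta> (snd z' 1)" for z z'
    by (simp add: cocycle_space_add ev_add)
  have ev_smult: "ev \<eta> (snd (k \<odot>\<^bsub>?Z\<^esub> z) 1) = k * ev \<eta> (snd z 1)" for k z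
    by (simp add: cocycle_space_smult ev_scl)
  have ne: "\<exists>z. z \<in> level s" for s
  proof -
    obtain z where "z \<in> ?C" "snd z 1 = scl V s v" using constant_cocycle[of s] by metis
    then show ?thesis by (intro exI[of _ z]) (simp add: level_def ev_generator)
  qed
  have add_mem: "z \<oplus>\<^bsub>?Z\<^esub> z' \<in> level (s + t)" if "z \<in> level s" "z' \<in> level t" for z z' s t
    using that V.cocycles_add ev_plus by (auto simp: level_def)
  have smult_mem: "k \<odot>\<^bsub>?Z\<^esub> z \<in> level (k * s)" if "z \<in> level s" for k z s
    using that V.cocycles_smult ev_smult by (auto simp: level_def)
  \<comment> \<open>The reverse inclusion for sums of level sets: subtract a given element of the
    level set of \<open>t\<close>.\<close>
  have diff_mem: "\<exists>x\<in>level s. z = x \<oplus>\<^bsub>?Z\<^esub> y" if "z \<in> level (s + t)" "y \<in> level t" for z y s t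
  proof
    show "z = (z \<oplus>\<^bsub>?Z\<^esub> ((-1) \<odot>\<^bsub>?Z\<^esub> y)) \<oplus>\<^bsub>?Z\<^esub> y" by (rule V.cocycle_diff_add[symmetric])
    show "z \<oplus>\<^bsub>?Z\<^esub> ((-1) \<odot>\<^bsub>?Z\<^esub> y) \<in> level s"
      using add_mem[OF that(1) smult_mem[OF that(2), of "-1"]] by simp
  qed
  have coset: "a_r_coset ?Z ?T z = level s" if "z \<in> level s" for z s
    unfolding T a_r_coset_def' using add_mem[OF _ that, of _ 0] diff_mem[OF _ that, of _ 0] by auto
  have level_inject: "s = t" if "level s = level t" for s t
    using ne[of s] that by (auto simp: level_def)
  show ?thesis
  proof (rule has_dim_1I[of _ level])
    have "A_RCOSETS ?Z ?T = (\<Union>z\<in>?C. {level (ev \<eta> (snd z 1))})"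
    proof -
      have "a_r_coset ?Z ?T z = level (ev \<eta> (snd z 1))" if "z \<in> ?C" for z
        by (rule coset) (simp add: level_def that)
      moreover have "carrier ?Z = ?C" by (simp add: cocycle_space_def)
      ultimately show ?thesis unfolding A_RCOSETS_def' by simp
    qed
    also have "\<dots> = range level"
    proof -
      have "(\<lambda>z. ev \<eta> (snd z 1)) ` ?C = UNIV"
      proof (intro equalityI subsetI)
        fix s :: complex
        obtain z where "z \<in> level s" using ne by blast
        then have "z \<in> ?C" "s = ev \<eta> (snd z 1)" by (simp_all add: level_def)
        then show "s \<in> (\<lambda>z. ev \<eta> (snd z 1)) ` ?C" by (rule image_eqI[rotated])
      qed simp
      then have "range level = level ` (\<lambda>z. ev \<eta> (snd z 1)) ` ?C" by simp
      then show ?thesis by (simp only: image_image UNION_singleton_eq_range)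
    qed
    finally have "A_RCOSETS ?Z ?T = range level" .
    then show "carrier (Ext R (one_dim_module \<eta>) V) = range level"
      by (simp add: Ext_def Let_def)
    show "inj level" by (rule injI) (rule level_inject)
    show "level s \<oplus>\<^bsub>Ext R (one_dim_module \<eta>) V\<^esub> level t = level (s + t)" for s t
    proof -
      obtain y where y: "y \<in> level t" using ne by blast
      have "set_add ?Z (level s) (level t) = level (s + t)"
        unfolding set_add_def'
      proof (intro equalityI subsetI)
        fix z assume "z \<in> level (s + t)"
        then obtain x where "x \<in> level s" "z = x \<oplus>\<^bsub>?Z\<^esub> y" using diff_mem[OF _ y] by blast
        then show "z \<in> (\<Union>x\<in>level s. \<Union>y\<in>level t. {x \<oplus>\<^bsub>?Z\<^esub> y})" using y by blast
      qed (auto intro: add_mem)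
      then show ?thesis by (simp add: Ext_def Let_def)
    qed
    show "\<zero>\<^bsub>Ext R (one_dim_module \<eta>) V\<^esub> = level 0"
      by (simp add: Ext_def Let_def T)
    show "k \<odot>\<^bsub>Ext R (one_dim_module \<eta>) V\<^esub> level s = level (k * s)" for k s
      using ne[of s] by (auto simp: Ext_def Let_def coset[OF smult_mem])
  qed
qed

end

end

theorem theorem6p4:
  fixes R :: "'r::ab_group_add lca" and A B :: 'r
    and a \<alpha> \<beta> \<eta> :: complex and Q :: "complex poly poly"
    and V :: "('r, 'v::ab_group_add) cmod" and v :: 'v
  assumes "typeII_lca R A B a Q" and "Q \<noteq> 0"
    and "rank_one_module R A B \<alpha> \<beta> V v" and "\<alpha> \<noteq> 0"
  shows
    "(\<forall>(E :: ('r, 'e::ab_group_add) cmod) i p.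
        extension R (one_dim_module \<eta>) V E i p \<longrightarrow>
          (\<exists>c f g h. ext_shape A B \<alpha> \<beta> \<eta> v E i p c f g h)) \<and>
     (\<forall>(E :: ('r, 'e) cmod) i p.
        extension R (one_dim_module \<eta>) V E i p \<and> \<not> trivial_ext (one_dim_module \<eta>) V E i p \<longrightarrow>
          \<beta> + \<eta> = 0 \<and> \<alpha> = 1) \<and>
     (\<beta> + \<eta> = 0 \<and> \<alpha> = 1 \<longrightarrow>
        (\<forall>(E :: ('r, 'e) cmod) i p.
           extension R (one_dim_module \<eta>) V E i p \<and> \<not> trivial_ext (one_dim_module \<eta>) V E i p \<longrightarrow>
             (\<exists>(E' :: ('r, 'v \<times> complex) cmod) i' p' c s.
                s \<noteq> 0 \<and> extension R (one_dim_module \<eta>) V E' i' p' \<and>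
                ext_shape A B \<alpha> \<beta> \<eta> v E' i' p' c (cnst s) 0 [:s:] \<and>
                equiv_ext E i p E' i' p')) \<and>
        (\<forall>s. s \<noteq> 0 \<longrightarrow>
             (\<exists>(E :: ('r, 'v \<times> complex) cmod) i p c.
                extension R (one_dim_module \<eta>) V E i p \<and>
                \<not> trivial_ext (one_dim_module \<eta>) V E i p \<and>
                ext_shape A B \<alpha> \<beta> \<eta> v E i p c (cnst s) 0 [:s:])) \<and>
        (\<forall>(E :: ('r, 'e) cmod) i p c s.
           s \<noteq> 0 \<and> extension R (one_dim_module \<eta>) V E i p \<and>
           ext_shape A B \<alpha> \<beta> \<eta> v E i p c (cnst s) 0 [:s:] \<longrightarrow>
             \<not> trivial_ext (one_dim_module \<eta>) V E i p) \<and>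
        has_dim (Ext R (one_dim_module \<eta>) V) 1)"
proof -
  interpret rank_one R V A B \<alpha> \<beta> v
  proof (intro rank_one.intro rank_one_axioms.intro)
    show "conf_mod R V" "bij (\<lambda>x. pact V x v)"
      "act V A v = pact2 V (dvar + cnst \<alpha> * lvar + cnst \<beta>) v" "act V B v = 0"
      using assms(3) by (simp_all add: rank_one_module_def conformal_module_iff)
    have "surj (\<lambda>(x, y). pact R x A + pact R y B)"
      using assms(1) by (simp add: typeII_lca_def bij_def)
    then show "\<exists>x y. b = pact R x A + pact R y B" for b
      by (drule_tac y = b in surjD) auto
  qed
  have shape_nontrivial: "\<not> trivial_ext (one_dim_module \<eta>) V E i p"
    if "s \<noteq> 0" and ext: "extension R (one_dim_module \<eta>) V E i p"
      and shape: "ext_shape A B \<alpha> \<beta> \<eta> v E i p c (cnst s) 0 [:s:]"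
    for E :: "('r, 'x::ab_group_add) cmod" and i p c s
  proof -
    interpret X: one_dim_ext R V E \<eta> i p by (rule V.one_dim_extI[OF ext])
    have "p c = 1" "del_minus E \<eta> c = i (scl V s v)"
      using shape by (simp_all add: ext_shape_def del_minus_def X.E.pact_const X.i_scl)
    then show ?thesis using trivial_ext_iff_0[OF ext] \<open>s \<noteq> 0\<close> by blast
  qed
  have normal: "\<exists>c s. s \<noteq> 0 \<and> p c = 1 \<and> del_minus E \<eta> c = i (scl V s v)"
    if ext: "extension R (one_dim_module \<eta>) V E i p" and nontrivial: "\<not> trivial_ext (one_dim_module \<eta>) V E i p"
    for E :: "('r, 'e) cmod" and i p
  proof -
    obtain c s where "p c = 1" "del_minus E \<eta> c = i (scl V s v)" by (rule normal_lift[OF ext])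
    with trivial_ext_iff_0[OF ext] nontrivial show ?thesis by blast
  qed
  have "\<beta> + \<eta> = 0 \<and> \<alpha> = 1"
    if "extension R (one_dim_module \<eta>) V E i p" "\<not> trivial_ext (one_dim_module \<eta>) V E i p"
    for E :: "('r, 'e) cmod" and i p
    using normal[OF that] parameters_of_nontrivial[OF that(1)] by blast
  moreover have "\<exists>(E' :: ('r, 'v \<times> complex) cmod) i' p' c s.
      s \<noteq> 0 \<and> extension R (one_dim_module \<eta>) V E' i' p' \<and>
      ext_shape A B \<alpha> \<beta> \<eta> v E' i' p' c (cnst s) 0 [:s:] \<and> equiv_ext E i p E' i' p'"
    if par: "\<alpha> = 1" "\<beta> + \<eta> = 0" and ext: "extension R (one_dim_module \<eta>) V E i p"
      and nontrivial: "\<not> trivial_ext (one_dim_module \<eta>) V E i p"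
    for E :: "('r, 'e) cmod" and i p
  proof -
    obtain c s where "s \<noteq> 0" and c: "p c = 1" "del_minus E \<eta> c = i (scl V s v)"
      using normal[OF ext nontrivial] by blast
    obtain z where z: "z \<in> cocycles R (one_dim_module \<eta>) V" "snd z 1 = scl V s v"
      "ext_shape A B \<alpha> \<beta> \<eta> v (twisted_sum (one_dim_module \<eta>) V z) inl snd (0, 1) (cnst s) 0 [:s:]"
      by (rule constant_cocycle[OF par])
    from c(2) have "del_minus E \<eta> c = i (snd z 1)" by (simp add: z(2))
    from one_dim_ext.equiv_twisted_sum[OF V.one_dim_extI[OF ext] c(1) this z(1)]
    show ?thesis using \<open>s \<noteq> 0\<close> z(3) V.extension_twisted_sum[OF z(1)] by blast
  qed
  moreover have "\<exists>(E :: ('r, 'v \<times> complex) cmod) i p c.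
      extension R (one_dim_module \<eta>) V E i p \<and> \<not> trivial_ext (one_dim_module \<eta>) V E i p \<and>
      ext_shape A B \<alpha> \<beta> \<eta> v E i p c (cnst s) 0 [:s:]"
    if par: "\<alpha> = 1" "\<beta> + \<eta> = 0" and "s \<noteq> 0" for s
  proof -
    obtain z where z: "z \<in> cocycles R (one_dim_module \<eta>) V"
      "ext_shape A B \<alpha> \<beta> \<eta> v (twisted_sum (one_dim_module \<eta>) V z) inl snd (0, 1) (cnst s) 0 [:s:]"
      by (rule constant_cocycle[OF par])
    show ?thesis
      using V.extension_twisted_sum[OF z(1)] z(2) shape_nontrivial[OF \<open>s \<noteq> 0\<close>] by blast
  qed
  ultimately show ?thesis
    using ext_shape_exists shape_nontrivial has_dim_Ext by blast
qed

end
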